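(* Let $M=(\Omega,P)$ be a Markov chain with an observation function $O:\Omega\to\Sigma$. Then there exists a canonical Markov chain $\hat M=(\hat\Omega,\hat P)$ and an injective map $\phi:\Omega\to\hat\Omega$ such that for any two states $a,a'\in\Omega$, $$\Omega\bigl(|\Sigma|\cdot\mathrm{NAQC}_M(a,a')\bigr)\le \mathrm{NAQC}_{\hat M}(\phi(a),\phi(a'))\le \tilde O\bigl(|\Sigma|\cdot\mathrm{NAQC}_M(a,a')^2\bigr).$$
   Context: A partially observable Markov chain $(\Omega,P,O)$ has finite state space $\Omega$, transition probabilities $P$ (from state $y$ the next state is drawn from $P(\cdot\mid y)$), and deterministic observation function $O:\Omega\to\Sigma$; states are hidden, only observations are visible. A canonical Markov chain is one with a sink state $s$ ($P(s\mid s)=1$) and observation function $O(x)=1$ if $x=s$, $0$ otherwise. A rewinding strategy is a (possibly randomized) function $A:\Sigma^*\to\mathbb{Z}_{\ge0}$: from initial state $X_0$, for $t\ge0$ set $Z_t=O(X_t)$ and draw $X_{t+1}\sim P(\cdot\mid X_{t'})$ with $t'=\max\{0,t-A(Z_0,\dots,Z_t)\}$, independently of everything else given $X_{t'}$ (each draw is a query); it is non-adaptive if $A(Z_0,\dots,Z_t)$ depends only on $t$. $\mathrm{QC}^A(a,b)$ is the least $T$ such that the total variation distance between $(Z_0,\dots,Z_T)$ under $X_0=a$ and under $X_0=b$ is at least $1/3$, and $\mathrm{NAQC}(a,b)=\min_A\mathrm{QC}^A(a,b)$ over non-adaptive rewinding strategies. $\tilde O$ hides polylogarithmic factors.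
   Formalization: The upper bound is proved with max(1, NAQC_M(a,a')) in place of NAQC_M(a,a'), since for pairs with NAQC_M(a,a') = 0 the literal bound Õ(0) = 0 fails (three states with three distinct observations); Σ is taken to be finite. *)

theory Defs
  imports "HOL-Probability.Probability"
begin

record ('s, 'o) pomc =
  states :: "'s set"
  transition :: "'s \<Rightarrow> 's pmf"
  alphabet :: "'o set"
  observe :: "'s \<Rightarrow> 'o"

definition po_markov_chain :: "('s, 'o) pomc \<Rightarrow> bool" where
  "po_markov_chain M \<longleftrightarrow>
     finite (states M) \<and> finite (alphabet M) \<and>
     (\<forall>x\<in>states M. set_pmf (transition M x) \<subseteq> states M) \<and>
     (\<forall>x\<in>states M. observe M x \<in> alphabet M)"

definition canonical_chain :: "('s, nat) pomc \<Rightarrow> bool" where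
  "canonical_chain M \<longleftrightarrow>
     po_markov_chain M \<and> alphabet M = {0, 1} \<and>
     (\<exists>s\<in>states M. transition M s = return_pmf s \<and>
        (\<forall>x\<in>states M. observe M x = (if x = s then 1 else 0)))"

text \<open>
  A randomized strategy is a random function from observation histories to rewinding
  lengths, given by its law on the product space. Point masses are the deterministic
  strategies. A history of each length is consulted only once, so fresh independent coins for
  every decision are covered as well.
\<close>

definition strategy_space :: "'o set \<Rightarrow> ('o list \<Rightarrow> nat) measure" where
  "strategy_space S = (\<Pi>\<^sub>M z\<in>lists S. count_space UNIV)"

definition rewinding_strategy :: "'o set \<Rightarrow> ('o list \<Rightarrow> nat) measure \<Rightarrow> bool" where
  "rewinding_strategy S A \<longleftrightarrow> prob_space A \<and> sets A = sets (strategy_space S)"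

definition nonadaptive :: "'o set \<Rightarrow> ('o list \<Rightarrow> nat) measure \<Rightarrow> bool" where
  "nonadaptive S A \<longleftrightarrow>
     (AE f in A. \<forall>z\<in>lists S. \<forall>z'\<in>lists S. length z = length z' \<longrightarrow> f z = f z')"

text \<open>
  The law of the hidden states \<open>[X\<^sub>0, \<dots>, X\<^sub>T]\<close> for a realization \<open>f\<close> of the strategy. The
  truncated subtraction is the index \<open>max {0, t - f (Z\<^sub>0, \<dots>, Z\<^sub>t)}\<close>.
\<close>

primrec run :: "('s, 'o) pomc \<Rightarrow> ('o list \<Rightarrow> nat) \<Rightarrow> 's \<Rightarrow> nat \<Rightarrow> 's list pmf" where
  "run M f x 0 = return_pmf [x]"
| "run M f x (Suc t) =
     bind_pmf (run M f x t) (\<lambda>xs.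
       map_pmf (\<lambda>y. xs @ [y]) (transition M (xs ! (t - f (map (observe M) xs)))))"

definition obs_prob ::
    "('s, 'o) pomc \<Rightarrow> ('o list \<Rightarrow> nat) measure \<Rightarrow> 's \<Rightarrow> nat \<Rightarrow> 'o list \<Rightarrow> real" where
  "obs_prob M A x T z = (\<integral>f. pmf (map_pmf (map (observe M)) (run M f x T)) z \<partial>A)"

definition obs_tv ::
    "('s, 'o) pomc \<Rightarrow> ('o list \<Rightarrow> nat) measure \<Rightarrow> 's \<Rightarrow> 's \<Rightarrow> nat \<Rightarrow> real" where
  "obs_tv M A a b T =
     1 / 2 * (\<Sum>z | z \<in> lists (alphabet M) \<and> length z = Suc T.
                \<bar>obs_prob M A a T z - obs_prob M A b T z\<bar>)"

text \<open>The infima are minima unless the set is empty, in which case the value is \<open>\<infinity>\<close>.\<close>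

definition QC :: "('s, 'o) pomc \<Rightarrow> ('o list \<Rightarrow> nat) measure \<Rightarrow> 's \<Rightarrow> 's \<Rightarrow> enat" where
  "QC M A a b = Inf {enat T | T. obs_tv M A a b T \<ge> 1 / 3}"

definition NAQC :: "('s, 'o) pomc \<Rightarrow> 's \<Rightarrow> 's \<Rightarrow> enat" where
  "NAQC M a b =
     Inf {QC M A a b | A. rewinding_strategy (alphabet M) A \<and> nonadaptive (alphabet M) A}"

text \<open>
  A bound \<open>soft_O(g)\<close> with leading constant \<open>C\<close> and exponent \<open>k\<close> of the logarithm; the shift
  by 2 keeps the logarithmic factor at least 1.
\<close>

definition soft_O_bound :: "real \<Rightarrow> nat \<Rightarrow> enat \<Rightarrow> ereal" where
  "soft_O_bound C k g =
     (case g of enat n \<Rightarrow> ereal (C * real n * log 2 (2 + real n) ^ k) | \<infinity> \<Rightarrow> \<infinity>)"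

end

theory Submission
  imports Defs
begin

text \<open>
  A deterministic non-adaptive strategy is a tree of queries, so both complexities are about
  trees. The canonical chain replaces every state \<open>y\<close> by a block of \<open>2 |\<Sigma>| + 1\<close>
  positions that are traversed in order. The walk falls into the sink with a small probability
  \<open>q\<close>, at a position in the second half of the block that encodes the observation of \<open>y\<close>, and
  otherwise enters the block of a random successor of \<open>y\<close>. A block reveals nothing before
  \<open>|\<Sigma>|\<close> queries have been spent in it, which gives the lower bound.

  For the upper bound, a tree of \<open>n\<close> queries is simulated with \<open>q\<close> about \<open>1/n\<close>, and each block is
  tried about \<open>n log n\<close> times. The event that no traversal dies and every block is read off has
  constant probability, is recognizable from the observations and is independent of the hidden
  states. Thus the canonical chain shows the original observations through an erasure channel.
  Since \<open>n\<close> depends on the pair of states, \<open>q = 2^-j\<close> is chosen at random in the first step, with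
  probability about \<open>1/j^2\<close> for the scale \<open>j\<close>. Wrong scales only contribute to the erasure
  probability. Independent repetitions, analysed with the Bhattacharyya coefficient, restore the
  total variation distance \<open>1/3\<close>.
\<close>

section \<open>Query trees\<close>

text \<open>
  First-child/next-sibling trees: \<open>Query l r\<close> queries the current state, runs \<open>l\<close> at the sampled
  state and then \<open>r\<close> at the current state again.
\<close>

datatype qtree = Stop | Query qtree qtree

text \<open>The samples are listed in preorder and the root \<open>x\<close> is left out, so the
  length of the list is \<open>size t\<close>, the number of queries.\<close>

primrec samp :: "('s \<Rightarrow> 's pmf) \<Rightarrow> qtree \<Rightarrow> 's \<Rightarrow> 's list pmf" where
  "samp P Stop x = return_pmf []"
| "samp P (Query l r) x =
     do {y \<leftarrow> P x; u \<leftarrow> samp P l y; v \<leftarrow> samp P r x; return_pmf (y # u @ v)}"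

lemma length_samp: "v \<in> set_pmf (samp P t x) \<Longrightarrow> length v = size t"
  by (induction t arbitrary: x v) fastforce+

primrec exec :: "('s \<Rightarrow> 's pmf) \<Rightarrow> nat list \<Rightarrow> 's list \<Rightarrow> 's list pmf" where
  "exec P [] xs = return_pmf xs"
| "exec P (p # ps) xs = do {y \<leftarrow> P (xs ! p); exec P ps (xs @ [y])}"

lemma exec_append: "exec P (ps @ qs) xs = do {ys \<leftarrow> exec P ps xs; exec P qs ys}"
  by (induction ps arbitrary: xs) (simp_all add: bind_return_pmf bind_assoc_pmf)

text \<open>\<open>i\<close> is the position of the current state in the history and
  \<open>n\<close> the position that the next sample will take.\<close>

primrec preorder :: "qtree \<Rightarrow> nat \<Rightarrow> nat \<Rightarrow> nat list" where
  "preorder Stop i n = []"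
| "preorder (Query l r) i n = i # preorder l n (Suc n) @ preorder r i (Suc n + size l)"

lemma length_preorder [simp]: "length (preorder t i n) = size t"
  by (induction t arbitrary: i n) auto

lemma preorder_less: "i < n \<Longrightarrow> k < size t \<Longrightarrow> preorder t i n ! k < n + k"
proof (induction t arbitrary: i n k)
  case (Query l r)
  show ?case
  proof (cases k)
    case (Suc m)
    show ?thesis
    proof (cases "m < size l")
      case True
      then show ?thesis using Query.IH(1)[of n "Suc n" m] Suc by (simp add: nth_append)
    next
      case False
      then show ?thesis using Query.IH(2)[of i "Suc n + size l" "m - size l"] Suc Query.prems
        by (simp add: nth_append)
    qed
  qed (use Query.prems in simp)
qed simp

text \<open>The subtree \<open>l\<close> consumes exactly \<open>size l\<close> samples, whatever
  their values, so the offset for \<open>r\<close> is known in advance.\<close>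

lemma exec_preorder:
  "i < length xs \<Longrightarrow> exec P (preorder t i (length xs)) xs = map_pmf ((@) xs) (samp P t (xs ! i))"
proof (induction t arbitrary: i xs)
  case Stop
  then show ?case by simp
next
  case (Query l r)
  have "exec P (preorder (Query l r) i (length xs)) xs =
    do {y \<leftarrow> P (xs ! i); u \<leftarrow> samp P l y; exec P (preorder r i (Suc (length xs) + size l)) (xs @ y # u)}"
    using Query.IH(1)[of "length xs" "xs @ [_]"]
    by (simp add: exec_append map_pmf_def bind_assoc_pmf bind_return_pmf)
  also have "\<dots> = do {y \<leftarrow> P (xs ! i); u \<leftarrow> samp P l y; v \<leftarrow> samp P r (xs ! i); return_pmf (xs @ y # u @ v)}"
  proof (intro bind_pmf_cong refl)
    fix y u assume "u \<in> set_pmf (samp P l y)"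
    then have "Suc (length xs) + size l = length (xs @ y # u)" by (simp add: length_samp)
    then show "exec P (preorder r i (Suc (length xs) + size l)) (xs @ y # u)
      = do {v \<leftarrow> samp P r (xs ! i); return_pmf (xs @ y # u @ v)}"
      using Query.IH(2)[of i "xs @ y # u"] Query.prems by (simp add: map_pmf_def nth_append)
  qed
  finally show ?case by (simp add: map_pmf_def bind_assoc_pmf bind_return_pmf)
qed

text \<open>Queries to the same state are exchangeable, so a new query to the \<open>k\<close>-th
  state can be inserted as its first child instead of being made last. \<open>m\<close> is the place
  of the new sample in preorder.\<close>

lemma samp_insert_query:
  "k \<le> size t \<Longrightarrow> \<exists>t' m. size t' = Suc (size t) \<and> m \<le> size t \<and>
     (\<forall>x. samp P t' x = do {v \<leftarrow> samp P t x; y \<leftarrow> P ((x # v) ! k); return_pmf (take m v @ y # drop m v)})"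
proof (induction t arbitrary: k)
  case Stop
  then show ?case
    by (intro exI[of _ "Query Stop Stop"] exI[of _ 0]) (simp add: bind_return_pmf)
next
  case (Query l r)
  consider (root) "k = 0" | (left) "0 < k" "k - 1 \<le> size l" | (right) "size l < k - 1" by linarith
  then show ?case
  proof cases
    case root
    have "samp P (Query Stop (Query l r)) x = do {v \<leftarrow> samp P (Query l r) x; y \<leftarrow> P x; return_pmf (y # v)}" for x
      by (subst bind_commute_pmf) (simp add: bind_return_pmf)
    then show ?thesis using root
      by (intro exI[of _ "Query Stop (Query l r)"] exI[of _ 0]) simp
  next
    case left
    from Query.IH(1)[OF left(2)] obtain t' m where t': "size t' = Suc (size l)" "m \<le> size l"
      "\<And>x. samp P t' x = do {v \<leftarrow> samp P l x; y \<leftarrow> P ((x # v) ! (k - 1)); return_pmf (take m v @ y # drop m v)}"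
      by blast
    have "samp P (Query t' r) x = do {v \<leftarrow> samp P (Query l r) x; y \<leftarrow> P ((x # v) ! k);
        return_pmf (take (Suc m) v @ y # drop (Suc m) v)}" for x
    proof -
      have "samp P (Query t' r) x = do {y' \<leftarrow> P x; u \<leftarrow> samp P l y'; y \<leftarrow> P ((y' # u) ! (k - 1));
          v \<leftarrow> samp P r x; return_pmf (y' # take m u @ y # drop m u @ v)}"
        by (simp add: t' bind_assoc_pmf bind_return_pmf)
      also have "\<dots> = do {y' \<leftarrow> P x; u \<leftarrow> samp P l y'; v \<leftarrow> samp P r x;
          y \<leftarrow> P ((y' # u) ! (k - 1)); return_pmf (y' # take m u @ y # drop m u @ v)}"
        by (subst bind_commute_pmf) (rule refl)
      also have "\<dots> = do {v \<leftarrow> samp P (Query l r) x; y \<leftarrow> P ((x # v) ! k);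
        return_pmf (take (Suc m) v @ y # drop (Suc m) v)}"
        using left t'(2) unfolding samp.simps bind_assoc_pmf bind_return_pmf
        by (intro bind_pmf_cong refl) (auto simp: nth_Cons' nth_append length_samp)
      finally show ?thesis .
    qed
    then show ?thesis using t'(1,2)
      by (intro exI[of _ "Query t' r"] exI[of _ "Suc m"]) (simp add: exI)
  next
    case right
    define k' where "k' = k - 1 - size l"
    have k': "k' \<le> size r" "k = Suc (k' + size l)" "0 < k'" using right Query.prems by (auto simp: k'_def)
    from Query.IH(2)[OF k'(1)] obtain t' m where t': "size t' = Suc (size r)" "m \<le> size r"
      "\<And>x. samp P t' x = do {v \<leftarrow> samp P r x; y \<leftarrow> P ((x # v) ! k'); return_pmf (take m v @ y # drop m v)}"
      by blast
    have "samp P (Query l t') x = do {v \<leftarrow> samp P (Query l r) x; y \<leftarrow> P ((x # v) ! k);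
        return_pmf (take (Suc (size l) + m) v @ y # drop (Suc (size l) + m) v)}" for x
      using k' unfolding samp.simps bind_assoc_pmf bind_return_pmf t'(3)
      by (intro bind_pmf_cong refl) (auto simp: nth_Cons' nth_append length_samp)
    then show ?thesis using t'(1,2)
      by (intro exI[of _ "Query l t'"] exI[of _ "Suc (size l) + m"]) simp
  qed
qed

text \<open>Counterpart of \<open>exec_preorder\<close>, up to reordering: the queries are moved
  into the tree one at a time, and \<open>is\<close> records the preorder index of the state of each
  time step.\<close>

lemma exec_as_samp:
  assumes "\<And>t. t < length ps \<Longrightarrow> ps ! t \<le> t"
  shows "\<exists>t is. size t = length ps \<and> length is = Suc (length ps) \<and> (\<forall>i\<in>set is. i \<le> size t) \<and>
     (\<forall>x. exec P ps [x] = map_pmf (\<lambda>v. map ((!) (x # v)) is) (samp P t x))"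
  using assms
proof (induction ps rule: rev_induct)
  case Nil
  then show ?case by (intro exI[of _ Stop] exI[of _ "[0]"]) simp
next
  case (snoc p ps)
  have "\<And>t. t < length ps \<Longrightarrow> ps ! t \<le> t"
    using snoc.prems by (metis length_append_singleton less_SucI nth_append)
  from snoc.IH[OF this] obtain t "is" where t: "size t = length ps" "length is = Suc (length ps)"
    "\<forall>i\<in>set is. i \<le> size t" "\<And>x. exec P ps [x] = map_pmf (\<lambda>v. map ((!) (x # v)) is) (samp P t x)"
    by blast
  have p: "p < length is" using snoc.prems[of "length ps"] t(2) by simp
  then have "is ! p \<le> size t" using t(3) by simp
  from samp_insert_query[OF this, of P] obtain t' m where t': "size t' = Suc (size t)" "m \<le> size t"
    "\<And>x. samp P t' x = do {v \<leftarrow> samp P t x; y \<leftarrow> P ((x # v) ! (is ! p)); return_pmf (take m v @ y # drop m v)}"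
    by blast
  \<comment> \<open>Index 0 is the root, so the new sample at place \<open>m\<close> has index
    \<open>Suc m\<close>, and old indices above \<open>m\<close> move up by one.\<close>
  define js where "js = map (\<lambda>i. if i \<le> m then i else Suc i) is @ [Suc m]"
  have "exec P (ps @ [p]) [x] = map_pmf (\<lambda>v. map ((!) (x # v)) js) (samp P t' x)" for x
    unfolding t' map_bind_pmf exec_append t(4) bind_map_pmf exec.simps map_return_pmf
  proof (intro bind_pmf_cong refl)
    fix v assume v: "v \<in> set_pmf (samp P t x)"
    show "P (map ((!) (x # v)) is ! p) = P ((x # v) ! (is ! p))" using p by simp
    fix y
    show "return_pmf (map ((!) (x # v)) is @ [y]) =
         return_pmf (map ((!) (x # take m v @ y # drop m v)) js)"
      using length_samp[OF v] t'(2) t(3)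
      by (auto simp: js_def nth_Cons' nth_append)
  qed
  moreover have "length js = Suc (length (ps @ [p]))" "\<forall>i\<in>set js. i \<le> size t'"
    using t t' by (auto simp: js_def)
  ultimately show ?case using t t' by (intro exI[of _ t'] exI[of _ js]) simp
qed

section \<open>Distinguishing distributions\<close>

text \<open>Total variation distance at least 1/3, stated through randomized tests \<open>g\<close>.
  This form passes through kernels and needs no common finite support.\<close>

definition distinguishable :: "'a pmf \<Rightarrow> 'a pmf \<Rightarrow> bool" where
  "distinguishable p q \<longleftrightarrow> (\<exists>g :: 'a \<Rightarrow> real. (\<forall>z. 0 \<le> g z \<and> g z \<le> 1) \<and>
     1 / 3 \<le> measure_pmf.expectation p g - measure_pmf.expectation q g)"

lemma expectation_bind_unit_interval:
  fixes g :: "'a \<Rightarrow> real"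
  assumes "\<And>z. 0 \<le> g z" "\<And>z. g z \<le> 1"
  shows "measure_pmf.expectation (bind_pmf p K) g =
           measure_pmf.expectation p (\<lambda>x. measure_pmf.expectation (K x) g)"
proof -
  have int: "integrable (measure_pmf q) g" for q
    using assms by (intro measure_pmf.integrable_const_bound[where B=1]) auto
  have le1: "measure_pmf.expectation q g \<le> 1" for q
    using assms int by (intro measure_pmf.integral_le_const) auto
  have "ennreal (measure_pmf.expectation (bind_pmf p K) g) =
          (\<integral>\<^sup>+ x. \<integral>\<^sup>+ y. ennreal (g y) \<partial>measure_pmf (K x) \<partial>measure_pmf p)"
    using nn_integral_eq_integral[OF int[of "bind_pmf p K"]] assms by simp
  also have "\<dots> = (\<integral>\<^sup>+ x. ennreal (measure_pmf.expectation (K x) g) \<partial>measure_pmf p)"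
    using assms by (intro nn_integral_cong nn_integral_eq_integral int) auto
  also have "\<dots> = ennreal (measure_pmf.expectation p (\<lambda>x. measure_pmf.expectation (K x) g))"
    using assms le1
    by (intro nn_integral_eq_integral measure_pmf.integrable_const_bound[where B=1]) auto
  finally show ?thesis using assms by (simp add: integral_nonneg)
qed

text \<open>Data processing: averaging a test over the kernel \<open>K\<close> gives a test for the
  inputs with the same advantage.\<close>

lemma distinguishable_bindD:
  assumes "distinguishable (bind_pmf p K) (bind_pmf q K)"
  shows "distinguishable p q"
proof -
  from assms obtain g :: "_ \<Rightarrow> real" where g: "\<And>z. 0 \<le> g z" "\<And>z. g z \<le> 1"
    "1 / 3 \<le> measure_pmf.expectation (bind_pmf p K) g - measure_pmf.expectation (bind_pmf q K) g"
    by (auto simp: distinguishable_def)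
  have "measure_pmf.expectation (K x) g \<le> 1" for x
    using g by (intro measure_pmf.integral_le_const measure_pmf.integrable_const_bound[where B=1]) auto
  then show ?thesis unfolding distinguishable_def
    using g by (intro exI[of _ "\<lambda>x. measure_pmf.expectation (K x) g"])
      (auto simp: expectation_bind_unit_interval)
qed

lemma distinguishable_mapD:
  "distinguishable (map_pmf f p) (map_pmf f q) \<Longrightarrow> distinguishable p q"
  unfolding map_pmf_def by (rule distinguishable_bindD)

lemma half_sum_abs_eq_sum_pos:
  fixes f g :: "'a \<Rightarrow> real"
  assumes "finite A" "sum f A = sum g A"
  shows "1 / 2 * (\<Sum>z\<in>A. \<bar>f z - g z\<bar>) = (\<Sum>z\<in>A. of_bool (g z < f z) * (f z - g z))"
proof -
  have "(\<Sum>z\<in>A. \<bar>f z - g z\<bar>) = (\<Sum>z\<in>A. 2 * (of_bool (g z < f z) * (f z - g z)) - (f z - g z))"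
    by (rule sum.cong) auto
  also have "\<dots> = 2 * (\<Sum>z\<in>A. of_bool (g z < f z) * (f z - g z))"
    using assms(2) by (simp only: sum_subtractf sum_distrib_left)
  finally show ?thesis by simp
qed

text \<open>The best test is the indicator of the set where \<open>p\<close> exceeds
  \<open>q\<close>; its advantage is the sum of the positive parts of the difference.\<close>

lemma distinguishable_iff_half_sum_abs:
  assumes "finite A" "set_pmf p \<subseteq> A" "set_pmf q \<subseteq> A"
  shows "distinguishable p q \<longleftrightarrow> 1 / 3 \<le> 1 / 2 * (\<Sum>z\<in>A. \<bar>pmf p z - pmf q z\<bar>)"
proof -
  have E: "measure_pmf.expectation p g - measure_pmf.expectation q g =
      (\<Sum>z\<in>A. g z * (pmf p z - pmf q z))" for g :: "_ \<Rightarrow> real"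
    using assms by (subst (1 2) integral_measure_pmf_real[of A])
      (auto simp: sum_subtractf[symmetric] right_diff_distrib)
  have tv: "1 / 2 * (\<Sum>z\<in>A. \<bar>pmf p z - pmf q z\<bar>) =
      (\<Sum>z\<in>A. of_bool (pmf q z < pmf p z) * (pmf p z - pmf q z))"
    using assms by (intro half_sum_abs_eq_sum_pos) (auto simp: sum_pmf_eq_1)
  show ?thesis
  proof
    assume "distinguishable p q"
    then obtain g :: "_ \<Rightarrow> real" where g: "\<And>z. 0 \<le> g z" "\<And>z. g z \<le> 1" "1 / 3 \<le> (\<Sum>z\<in>A. g z * (pmf p z - pmf q z))"
      by (auto simp: distinguishable_def E)
    have "(\<Sum>z\<in>A. g z * (pmf p z - pmf q z)) \<le>
        (\<Sum>z\<in>A. of_bool (pmf q z < pmf p z) * (pmf p z - pmf q z))"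
    proof (rule sum_mono)
      fix z
      show "g z * (pmf p z - pmf q z) \<le> of_bool (pmf q z < pmf p z) * (pmf p z - pmf q z)"
        using g(1,2)[of z] by (auto simp: mult_left_le_one_le mult_nonneg_nonpos)
    qed
    then show "1 / 3 \<le> 1 / 2 * (\<Sum>z\<in>A. \<bar>pmf p z - pmf q z\<bar>)" using g(3) tv by simp
  next
    assume "1 / 3 \<le> 1 / 2 * (\<Sum>z\<in>A. \<bar>pmf p z - pmf q z\<bar>)"
    then show "distinguishable p q"
      unfolding tv distinguishable_def E by (intro exI[of _ "\<lambda>z. of_bool (pmf q z < pmf p z)"]) auto
  qed
qed

section \<open>Bernoulli variables and the erasure channel\<close>

lemma bool_pmf_eqI: "pmf p True = pmf q True \<Longrightarrow> p = (q :: bool pmf)"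
proof (rule pmf_eqI)
  fix b assume eq: "pmf p True = pmf q True"
  have "(\<Sum>b\<in>UNIV. pmf r b) = 1" for r :: "bool pmf" by (rule sum_pmf_eq_1) auto
  then have "pmf r False = 1 - pmf r True" for r :: "bool pmf"
    unfolding UNIV_bool by (simp add: eq_diff_eq)
  then show "pmf p b = pmf q b" using eq by (cases b) simp_all
qed

lemma bernoulli_and:
  assumes "0 \<le> c" "c \<le> 1" "0 \<le> d" "d \<le> 1"
  shows "do {b \<leftarrow> bernoulli_pmf c; b' \<leftarrow> bernoulli_pmf d; return_pmf (b \<and> b')} = bernoulli_pmf (c * d)"
  using assms
  by (intro bool_pmf_eqI) (simp add: pmf_bind[of "bernoulli_pmf c"] bind_return_pmf' mult_le_one mult.commute)

lemma bernoulli_or: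
  assumes "0 \<le> c" "c \<le> 1" "0 \<le> d" "d \<le> 1"
  shows "do {b \<leftarrow> bernoulli_pmf c; b' \<leftarrow> bernoulli_pmf d; return_pmf (b \<or> b')} =
    bernoulli_pmf (1 - (1 - c) * (1 - d))"
proof (rule bool_pmf_eqI)
  have "0 \<le> (1 - c) * (1 - d)" "(1 - c) * (1 - d) \<le> 1" using assms by (auto intro: mult_le_one)
  then show "pmf (do {b \<leftarrow> bernoulli_pmf c; b' \<leftarrow> bernoulli_pmf d; return_pmf (b \<or> b')}) True =
      pmf (bernoulli_pmf (1 - (1 - c) * (1 - d))) True"
    using assms by (simp add: pmf_bind[of "bernoulli_pmf c"] bind_return_pmf') (simp add: algebra_simps)
qed

lemma bernoulli_not:
  "0 \<le> c \<Longrightarrow> c \<le> 1 \<Longrightarrow> map_pmf Not (bernoulli_pmf c) = bernoulli_pmf (1 - c)"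
  by (intro bool_pmf_eqI) (simp add: map_pmf_def pmf_bind)

text \<open>\<open>c\<close> is the probability that the sample survives, not that it is
  erased.\<close>

definition erase :: "real \<Rightarrow> 'a pmf \<Rightarrow> 'a option pmf" where
  "erase c p = do {b \<leftarrow> bernoulli_pmf c; if b then map_pmf Some p else return_pmf None}"

lemma bind_erase: "bind_pmf p (\<lambda>x. erase c (q x)) = erase c (bind_pmf p q)"
proof -
  have "bind_pmf p (\<lambda>x. erase c (q x)) =
      do {b \<leftarrow> bernoulli_pmf c; x \<leftarrow> p; if b then map_pmf Some (q x) else return_pmf None}"
    unfolding erase_def by (rule bind_commute_pmf)
  also have "\<dots> = erase c (bind_pmf p q)"
    unfolding erase_def by (intro bind_pmf_cong refl) (simp add: map_bind_pmf)
  finally show ?thesis .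
qed

text \<open>\<open>f\<close> is strict in \<open>None\<close>, so the result survives exactly if
  both independent coins succeed.\<close>

lemma erase_product:
  assumes cd: "0 \<le> c" "c \<le> 1" "0 \<le> d" "d \<le> 1"
    and f: "\<And>B. f None B = None" "\<And>A. f A None = None"
      "\<And>u v. u \<in> set_pmf p \<Longrightarrow> v \<in> set_pmf q \<Longrightarrow> f (Some u) (Some v) = Some (g u v)"
  shows "do {A \<leftarrow> erase c p; B \<leftarrow> erase d q; return_pmf (f A B)} =
    erase (c * d) (do {u \<leftarrow> p; v \<leftarrow> q; return_pmf (g u v)})"
proof -
  let ?e = "\<lambda>b r. if b then map_pmf Some r else return_pmf None"
  have "do {A \<leftarrow> erase c p; B \<leftarrow> erase d q; return_pmf (f A B)} =
      do {b \<leftarrow> bernoulli_pmf c; b' \<leftarrow> bernoulli_pmf d; A \<leftarrow> ?e b p; B \<leftarrow> ?e b' q; return_pmf (f A B)}"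
    unfolding erase_def bind_assoc_pmf by (subst (2) bind_commute_pmf) (rule refl)
  also have "\<dots> = do {b \<leftarrow> bernoulli_pmf c; b' \<leftarrow> bernoulli_pmf d;
      ?e (b \<and> b') (do {u \<leftarrow> p; v \<leftarrow> q; return_pmf (g u v)})}"
  proof (intro bind_pmf_cong refl)
    fix b b'
    show "do {A \<leftarrow> ?e b p; B \<leftarrow> ?e b' q; return_pmf (f A B)} =
        ?e (b \<and> b') (do {u \<leftarrow> p; v \<leftarrow> q; return_pmf (g u v)})"
      by (cases b; cases b')
        (auto simp: f bind_return_pmf bind_map_pmf map_bind_pmf intro!: bind_pmf_cong)
  qed
  also have "\<dots> = bind_pmf (do {b \<leftarrow> bernoulli_pmf c; b' \<leftarrow> bernoulli_pmf d; return_pmf (b \<and> b')})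
      (\<lambda>b. ?e b (do {u \<leftarrow> p; v \<leftarrow> q; return_pmf (g u v)}))"
    by (simp add: bind_assoc_pmf bind_return_pmf)
  also have "\<dots> = erase (c * d) (do {u \<leftarrow> p; v \<leftarrow> q; return_pmf (g u v)})"
    using cd by (simp add: bernoulli_and erase_def)
  finally show ?thesis .
qed

lemma erase_failure:
  assumes "0 \<le> c" "c \<le> 1" "0 \<le> d" "d \<le> 1"
  shows "do {b \<leftarrow> bernoulli_pmf c; if b then return_pmf None else erase d p} = erase ((1 - c) * d) p"
proof -
  have "do {b \<leftarrow> bernoulli_pmf c; if b then return_pmf None else erase d p} =
      do {b \<leftarrow> map_pmf Not (bernoulli_pmf c); b' \<leftarrow> bernoulli_pmf d;
        if b \<and> b' then map_pmf Some p else return_pmf None}"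
    unfolding bind_map_pmf by (intro bind_pmf_cong refl) (simp add: erase_def)
  also have "\<dots> = bind_pmf (do {b \<leftarrow> bernoulli_pmf (1 - c); b' \<leftarrow> bernoulli_pmf d; return_pmf (b \<and> b')})
      (\<lambda>b. if b then map_pmf Some p else return_pmf None)"
    using assms by (simp add: bernoulli_not bind_assoc_pmf bind_return_pmf)
  also have "\<dots> = erase ((1 - c) * d) p"
    using assms by (subst bernoulli_and) (simp_all add: erase_def)
  finally show ?thesis .
qed

text \<open>The content \<open>p\<close> does not depend on \<open>j\<close>, so only the mean
  survival probability matters. This makes a random scale usable: wrong scales merely lower the
  mean.\<close>

lemma erase_mixture:
  assumes "finite (set_pmf w)" "\<And>j. 0 \<le> c j" "\<And>j. c j \<le> 1"
  shows "bind_pmf w (\<lambda>j. erase (c j) p) = erase (measure_pmf.expectation w c) p"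
proof -
  have int: "integrable w c" using assms(1) by (rule integrable_measure_pmf_finite)
  have "bind_pmf w (\<lambda>j. bernoulli_pmf (c j)) = bernoulli_pmf (measure_pmf.expectation w c)"
    using assms int
    by (intro bool_pmf_eqI) (simp add: pmf_bind integral_nonneg measure_pmf.integral_le_const)
  then show ?thesis unfolding erase_def by (simp add: bind_assoc_pmf[symmetric])
qed

lemma pmf_erase:
  assumes "0 \<le> c" "c \<le> 1"
  shows "pmf (erase c p) None = 1 - c" "pmf (erase c p) (Some x) = c * pmf p x"
  using assms by (simp_all add: erase_def pmf_bind pmf_map_outside pmf_map_inj' inj_Some)

lemma set_erase: "set_pmf (erase c p) \<subseteq> insert None (Some ` set_pmf p)"
  by (auto simp: erase_def split: if_splits)

section \<open>The Bhattacharyya coefficient\<close>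

definition bhattacharyya :: "'a pmf \<Rightarrow> 'a pmf \<Rightarrow> real" where
  "bhattacharyya p q = (\<Sum>z\<in>set_pmf p. sqrt (pmf p z * pmf q z))"

lemma bhattacharyya_superset:
  "finite A \<Longrightarrow> set_pmf p \<subseteq> A \<Longrightarrow> bhattacharyya p q = (\<Sum>z\<in>A. sqrt (pmf p z * pmf q z))"
  unfolding bhattacharyya_def by (intro sum.mono_neutral_left) (auto simp: set_pmf_iff)

lemma bhattacharyya_map_inj:
  "inj f \<Longrightarrow> bhattacharyya (map_pmf f p) (map_pmf f q) = bhattacharyya p q"
  unfolding bhattacharyya_def set_map_pmf
  by (subst sum.reindex) (auto simp: pmf_map_inj' intro: inj_on_subset)

lemma bhattacharyya_pair:
  "bhattacharyya (pair_pmf p p') (pair_pmf q q') = bhattacharyya p q * bhattacharyya p' q'"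
  unfolding bhattacharyya_def set_pair_pmf sum_product sum.cartesian_product
  by (rule sum.cong) (auto simp: pmf_pair real_sqrt_mult)

lemma bhattacharyya_replicate:
  "bhattacharyya (replicate_pmf n p) (replicate_pmf n q) = bhattacharyya p q ^ n"
proof (induction n)
  case 0
  then show ?case by (simp add: bhattacharyya_def)
next
  case (Suc n)
  have eq: "replicate_pmf (Suc n) r = map_pmf (\<lambda>(x, xs). x # xs) (pair_pmf r (replicate_pmf n r))" for r :: "'a pmf"
    by (simp add: pair_pmf_def map_bind_pmf)
  show ?case unfolding eq using Suc
    by (subst bhattacharyya_map_inj) (auto simp: inj_on_def bhattacharyya_pair)
qed

text \<open>\<open>None\<close> has mass \<open>1 - c\<close> under both laws and contributes it in
  full; the surviving part scales by \<open>c\<close>.\<close>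

lemma bhattacharyya_erase:
  assumes "0 \<le> c" "c \<le> 1" "finite (set_pmf p)"
  shows "bhattacharyya (erase c p) (erase c q) = (1 - c) + c * bhattacharyya p q"
proof -
  have "bhattacharyya (erase c p) (erase c q) =
      (\<Sum>z\<in>insert None (Some ` set_pmf p). sqrt (pmf (erase c p) z * pmf (erase c q) z))"
    using assms by (intro bhattacharyya_superset set_erase) simp
  also have "\<dots> = (1 - c) + (\<Sum>z\<in>set_pmf p. sqrt ((c * pmf p z) * (c * pmf q z)))"
    using assms by (simp add: sum.reindex pmf_erase)
  also have "sqrt ((c * x) * (c * y)) = c * sqrt (x * y)" for x y
    using assms by (simp add: real_sqrt_mult)
  then have "(\<Sum>z\<in>set_pmf p. sqrt ((c * pmf p z) * (c * pmf q z))) = c * bhattacharyya p q"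
    by (simp only: bhattacharyya_def sum_distrib_left)
  finally show ?thesis .
qed

lemma sum_min_max_pmf:
  assumes "finite A" "set_pmf p \<subseteq> A" "set_pmf q \<subseteq> A"
  defines "d \<equiv> 1 / 2 * (\<Sum>z\<in>A. \<bar>pmf p z - pmf q z\<bar>)"
  shows "(\<Sum>z\<in>A. min (pmf p z) (pmf q z)) = 1 - d" "(\<Sum>z\<in>A. max (pmf p z) (pmf q z)) = 1 + d"
proof -
  have "(\<Sum>z\<in>A. pmf p z) = 1" "(\<Sum>z\<in>A. pmf q z) = 1" using assms by (auto intro: sum_pmf_eq_1)
  moreover have "min (pmf p z) (pmf q z) = (pmf p z + pmf q z - \<bar>pmf p z - pmf q z\<bar>) / 2"
    "max (pmf p z) (pmf q z) = (pmf p z + pmf q z + \<bar>pmf p z - pmf q z\<bar>) / 2" for z by auto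
  ultimately show "(\<Sum>z\<in>A. min (pmf p z) (pmf q z)) = 1 - d" "(\<Sum>z\<in>A. max (pmf p z) (pmf q z)) = 1 + d"
    by (simp_all only: sum_divide_distrib[symmetric] sum.distrib sum_subtractf d_def) simp_all
qed

text \<open>Cauchy-Schwarz for the square roots of the pointwise minimum and maximum, whose squares
  sum to \<open>1 - d\<close> and \<open>1 + d\<close> for the total variation distance
  \<open>d\<close>.\<close>

lemma bhattacharyya_le_if_distinguishable:
  assumes "finite (set_pmf p)" "finite (set_pmf q)" "distinguishable p q"
  shows "bhattacharyya p q \<le> 19 / 20"
proof -
  define A where "A = set_pmf p \<union> set_pmf q"
  have A: "finite A" "set_pmf p \<subseteq> A" "set_pmf q \<subseteq> A" using assms by (auto simp: A_def)
  define d where "d = 1 / 2 * (\<Sum>z\<in>A. \<bar>pmf p z - pmf q z\<bar>)"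
  have d: "1 / 3 \<le> d" using distinguishable_iff_half_sum_abs[OF A] assms(3) by (simp add: d_def)
  have "bhattacharyya p q = (\<Sum>z\<in>A. sqrt (min (pmf p z) (pmf q z)) * sqrt (max (pmf p z) (pmf q z)))"
    unfolding bhattacharyya_superset[OF A(1,2)]
    by (rule sum.cong) (auto simp: real_sqrt_mult[symmetric] min_def max_def mult.commute)
  then have "(bhattacharyya p q)\<^sup>2 \<le> (1 - d) * (1 + d)"
    using Cauchy_Schwarz_ineq_sum[of "\<lambda>z. sqrt (min (pmf p z) (pmf q z))" "\<lambda>z. sqrt (max (pmf p z) (pmf q z))" A]
    by (simp add: sum_min_max_pmf[OF A] d_def le_max_iff_disj)
  also have "\<dots> = 1 - d\<^sup>2" by (simp add: power2_eq_square algebra_simps)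
  \<comment> \<open>As \<open>d\<close> is at least 1/3, the left side is at most 8/9, which is
    below 361/400.\<close>
  also have "\<dots> \<le> (19 / 20)\<^sup>2" using power_mono[OF d, of 2] by (simp add: power2_eq_square)
  finally show ?thesis by (rule power2_le_imp_le) simp
qed

text \<open>The minimum is at most the geometric mean, so \<open>1 - d\<close> is at most the
  coefficient.\<close>

lemma distinguishable_if_bhattacharyya_le:
  assumes "finite (set_pmf p)" "finite (set_pmf q)" "bhattacharyya p q \<le> 2 / 3"
  shows "distinguishable p q"
proof -
  define A where "A = set_pmf p \<union> set_pmf q"
  have A: "finite A" "set_pmf p \<subseteq> A" "set_pmf q \<subseteq> A" using assms by (auto simp: A_def)
  have "(\<Sum>z\<in>A. min (pmf p z) (pmf q z)) \<le> bhattacharyya p q"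
    unfolding bhattacharyya_superset[OF A(1,2)]
  proof (rule sum_mono)
    fix z
    have "(min (pmf p z) (pmf q z))\<^sup>2 \<le> pmf p z * pmf q z"
      unfolding power2_eq_square by (intro mult_mono) auto
    then show "min (pmf p z) (pmf q z) \<le> sqrt (pmf p z * pmf q z)" by (rule real_le_rsqrt)
  qed
  then show ?thesis using assms(3)
    by (simp add: distinguishable_iff_half_sum_abs[OF A] sum_min_max_pmf[OF A])
qed

section \<open>Non-adaptive strategies as query trees\<close>

text \<open>The observation of the root is left out, as in \<open>samp\<close>; it is put back by
  \<open>Cons (observe M x)\<close> where complexities are concerned.\<close>

definition observed :: "('s, 'o) pomc \<Rightarrow> qtree \<Rightarrow> 's \<Rightarrow> 'o list pmf" where
  "observed M t x = map_pmf (map (observe M)) (samp (transition M) t x)"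

lemma length_run: "xs \<in> set_pmf (run M f x T) \<Longrightarrow> length xs = Suc T"
  by (induction T arbitrary: xs) auto

lemma set_run:
  assumes "po_markov_chain M" "x \<in> states M"
  shows "set_pmf (run M f x T) \<subseteq> {xs. xs \<in> lists (states M) \<and> length xs = Suc T}"
proof (induction T)
  case (Suc T)
  have "xs ! (T - k) \<in> states M" if "xs \<in> set_pmf (run M f x T)" for xs k
    using that Suc by (auto simp: subset_iff in_lists_conv_set)
  then show ?case using assms(1) Suc
    by (fastforce simp: po_markov_chain_def subset_iff in_lists_conv_set)
qed (use assms in simp)

text \<open>A strategy that sees only the length of the history is a fixed list of positions. At
  time \<open>t\<close> the history has length \<open>Suc t\<close>.\<close>

lemma run_eq_exec:
  assumes "po_markov_chain M" "x \<in> states M"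
    and "\<And>z. z \<in> lists (alphabet M) \<Longrightarrow> f z = h (length z)"
  shows "run M f x T = exec (transition M) (map (\<lambda>t. t - h (Suc t)) [0..<T]) [x]"
proof (induction T)
  case 0
  then show ?case by simp
next
  case (Suc T)
  have "run M f x (Suc T) = bind_pmf (run M f x T) (\<lambda>xs. exec (transition M) [T - h (Suc T)] xs)"
    unfolding run.simps
  proof (intro bind_pmf_cong refl)
    fix xs assume "xs \<in> set_pmf (run M f x T)"
    then have xs: "xs \<in> lists (states M)" "length xs = Suc T" using set_run[OF assms(1,2)] by auto
    with assms(1) have "map (observe M) xs \<in> lists (alphabet M)"
      by (auto simp: po_markov_chain_def)
    from assms(3)[OF this] xs(2)
    show "map_pmf (\<lambda>y. xs @ [y]) (transition M (xs ! (T - f (map (observe M) xs)))) =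
        exec (transition M) [T - h (Suc T)] xs" by (simp add: map_pmf_def)
  qed
  then show ?case using Suc by (simp add: exec_append)
qed

section \<open>Measurability and removal of the randomness\<close>

lemma borel_measurable_pmf_run:
  assumes M: "po_markov_chain M" and A: "sets A = sets (strategy_space (alphabet M))"
    and x: "x \<in> states M"
  shows "xs \<in> lists (states M) \<Longrightarrow> (\<lambda>f. pmf (run M f x T) xs) \<in> borel_measurable A"
proof (induction T arbitrary: xs)
  case 0
  then show ?case by simp
next
  case (Suc T)
  show ?case
  proof (cases "length xs = Suc (Suc T)")
    case False
    then have "xs \<notin> set_pmf (run M f x (Suc T))" for f using length_run by metis
    then have "pmf (run M f x (Suc T)) xs = 0" for f by (metis set_pmf_iff)
    then show ?thesis by (simp del: run.simps)
  next
    case True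
    then obtain ys y where xs: "xs = ys @ [y]" by (metis Zero_not_Suc list.size(3) rev_exhaust)
    have ys: "ys \<in> lists (states M)" "length ys = Suc T" using Suc.prems True by (auto simp: xs)
    let ?z = "map (observe M) ys"
    have z: "?z \<in> lists (alphabet M)" using M ys by (auto simp: po_markov_chain_def)
    \<comment> \<open>A run ends in \<open>ys @ [y]\<close> only through the prefix
      \<open>ys\<close>, so the last draw depends on \<open>f\<close> through the single coordinate
      \<open>?z\<close>.\<close>
    have "pmf (run M f x (Suc T)) xs =
       pmf (run M f x T) ys * pmf (transition M (ys ! (T - f ?z))) y" for f
    proof -
      have "pmf (run M f x (Suc T)) xs = measure_pmf.expectation (run M f x T)
          (\<lambda>zs. of_bool (zs = ys) * pmf (transition M (ys ! (T - f ?z))) y)"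
        unfolding run.simps pmf_bind
      proof (intro integral_cong_AE; (simp add: AE_measure_pmf_iff)?; intro ballI conjI impI)
        fix zs
        show "zs \<noteq> ys \<Longrightarrow> pmf (map_pmf (\<lambda>y. zs @ [y]) (transition M (zs ! (T - f (map (observe M) zs))))) xs = 0"
          by (intro pmf_map_outside) (auto simp: xs)
        show "pmf (map_pmf (\<lambda>y. ys @ [y]) (transition M (ys ! (T - f ?z)))) xs = pmf (transition M (ys ! (T - f ?z))) y"
          unfolding xs by (rule pmf_map_inj') (auto intro: injI)
      qed
      also have "\<dots> = pmf (run M f x T) ys * pmf (transition M (ys ! (T - f ?z))) y"
        by (subst integral_measure_pmf_real[of "{ys}"]) auto
      finally show ?thesis .
    qed
    moreover have "(\<lambda>f. f ?z) \<in> A \<rightarrow>\<^sub>M count_space UNIV"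
      unfolding measurable_cong_sets[OF A refl] strategy_space_def
      using z by (rule measurable_component_singleton)
    then have "(\<lambda>f. pmf (transition M (ys ! (T - f ?z))) y) \<in> borel_measurable A"
      by (rule measurable_compose) simp
    ultimately show ?thesis using Suc.IH[OF ys(1)] by simp
  qed
qed
lemma borel_measurable_pmf_map_run:
  assumes M: "po_markov_chain M" and A: "sets A = sets (strategy_space (alphabet M))"
    and x: "x \<in> states M"
  shows "(\<lambda>f. pmf (map_pmf (map (observe M)) (run M f x T)) z) \<in> borel_measurable A"
proof -
  define X where "X = {xs \<in> lists (states M). length xs = Suc T \<and> map (observe M) xs = z}"
  have "finite X" using M finite_lists_length_eq[of "states M" "Suc T"]
    by (auto simp: X_def po_markov_chain_def lists_eq_set elim!: rev_finite_subset)
  have "pmf (map_pmf (map (observe M)) (run M f x T)) z = (\<Sum>xs\<in>X. pmf (run M f x T) xs)" for f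
  proof -
    have "map (observe M) -` {z} \<inter> set_pmf (run M f x T) = X \<inter> set_pmf (run M f x T)"
      using set_run[OF M x] by (auto simp: X_def)
    then have "measure_pmf.prob (run M f x T) (map (observe M) -` {z}) = measure_pmf.prob (run M f x T) X"
      by (metis measure_Int_set_pmf)
    then show ?thesis using \<open>finite X\<close> by (simp add: pmf_map measure_measure_pmf_finite)
  qed
  then show ?thesis
    using borel_measurable_pmf_run[OF M A x] by (auto simp: X_def intro!: borel_measurable_sum)
qed

lemma set_map_run:
  assumes "po_markov_chain M" "x \<in> states M"
  shows "set_pmf (map_pmf (map (observe M)) (run M f x T)) \<subseteq>
    {z. z \<in> lists (alphabet M) \<and> length z = Suc T}"
  using set_run[OF assms, of f T] assms(1) by (fastforce simp: po_markov_chain_def)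

text \<open>The advantage of a fixed test under \<open>A\<close> is the average of its advantages
  over the realizations, so some realization with \<open>Q\<close> does at least as well.
  \<open>Q\<close> will be non-adaptivity.\<close>

lemma obs_tv_randomized_imp_deterministic:
  assumes M: "po_markov_chain M" and x: "a \<in> states M" "b \<in> states M"
    and A: "rewinding_strategy (alphabet M) A" "AE f in A. Q f" and tv: "1 / 3 \<le> obs_tv M A a b T"
  shows "\<exists>f. Q f \<and> distinguishable (map_pmf (map (observe M)) (run M f a T))
            (map_pmf (map (observe M)) (run M f b T))"
proof (rule ccontr)
  assume neg: "\<not> ?thesis"
  let ?p = "\<lambda>f x. map_pmf (map (observe M)) (run M f x T)"
  define F where "F = {z. z \<in> lists (alphabet M) \<and> length z = Suc T}"
  have finF: "finite F" using M finite_lists_length_eq[of "alphabet M" "Suc T"]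
    by (auto simp: F_def po_markov_chain_def lists_eq_set elim!: rev_finite_subset)
  interpret A: prob_space A using A by (simp add: rewinding_strategy_def)
  have setsA: "sets A = sets (strategy_space (alphabet M))" using A by (simp add: rewinding_strategy_def)
  have int: "integrable A (\<lambda>f. pmf (?p f y) z)" if "y \<in> states M" for y z
    by (rule A.integrable_const_bound[where B=1])
      (auto simp: pmf_le_1 borel_measurable_pmf_map_run[OF M setsA that])
  have one: "(\<Sum>z\<in>F. pmf (?p f y) z) = 1" if "y \<in> states M" for f y
    using finF set_map_run[OF M that] by (intro sum_pmf_eq_1) (auto simp: F_def)
  have sum1: "(\<Sum>z\<in>F. obs_prob M A y T z) = 1" if "y \<in> states M" for y
    unfolding obs_prob_def using int[OF that] one[OF that]
    by (subst Bochner_Integration.integral_sum[symmetric]) (auto simp: A.prob_space)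
  define g :: "_ \<Rightarrow> real" where "g z = of_bool (obs_prob M A b T z < obs_prob M A a T z)" for z
  define G where "G f = (\<Sum>z\<in>F. g z * (pmf (?p f a) z - pmf (?p f b) z))" for f
  have intG: "integrable A G" unfolding G_def using int x by auto
  have "1 / 3 \<le> (\<Sum>z\<in>F. g z * (obs_prob M A a T z - obs_prob M A b T z))"
    using tv half_sum_abs_eq_sum_pos[OF finF, of "obs_prob M A a T" "obs_prob M A b T"] sum1 x
    by (simp add: obs_tv_def F_def g_def)
  also have "\<dots> = A.expectation G"
    unfolding obs_prob_def G_def using int x by simp
  finally have "1 / 3 \<le> A.expectation G" .
  moreover have "AE f in A. G f < 1 / 3"
    using A(2)
  proof eventually_elim
    fix f assume "Q f"
    with neg have nd: "\<not> distinguishable (?p f a) (?p f b)" by blast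
    have "G f = measure_pmf.expectation (?p f a) g - measure_pmf.expectation (?p f b) g"
      using finF set_map_run[OF M x(1), of f T] set_map_run[OF M x(2), of f T]
      by (subst (1 2) integral_measure_pmf_real[of F])
        (auto simp: F_def G_def sum_subtractf[symmetric] right_diff_distrib simp del: set_map_pmf integral_map_pmf)
    moreover have "\<forall>z. 0 \<le> g z \<and> g z \<le> 1" by (simp add: g_def)
    ultimately show "G f < 1 / 3"
      using nd unfolding distinguishable_def not_ex by (metis not_le)
  qed
  then have "A.expectation G < 1 / 3" by (rule A.expectation_less[OF intG])
  ultimately show False by simp
qed

lemma Inf_enat_le_iff: "Inf S \<le> enat T \<longleftrightarrow> (\<exists>x\<in>S. x \<le> enat T)"
proof -
  have "x \<le> enat T \<longleftrightarrow> x < enat (Suc T)" for x by (cases x) auto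
  then show ?thesis by (simp only: Inf_less_iff)
qed

text \<open>Bridge from strategies to trees: averaging removes the randomness,
  \<open>exec_as_samp\<close> turns a fixed strategy into a tree, and a preorder traversal turns a
  tree into a strategy.\<close>

lemma NAQC_le_iff_qtree:
  assumes M: "po_markov_chain M" and ab: "a \<in> states M" "b \<in> states M"
  shows "NAQC M a b \<le> enat T \<longleftrightarrow>
    (\<exists>t. size t \<le> T \<and> distinguishable (map_pmf (Cons (observe M a)) (observed M t a))
                                        (map_pmf (Cons (observe M b)) (observed M t b)))"
    (is "_ \<longleftrightarrow> (\<exists>t. _ \<and> distinguishable (?o t a) (?o t b))")
proof
  assume "NAQC M a b \<le> enat T"
  then obtain A T0 where A: "rewinding_strategy (alphabet M) A" "nonadaptive (alphabet M) A"
    and T0: "T0 \<le> T" "1 / 3 \<le> obs_tv M A a b T0"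
    by (auto simp: NAQC_def QC_def Inf_enat_le_iff)
  from obs_tv_randomized_imp_deterministic[OF M ab A(1) A(2)[unfolded nonadaptive_def] T0(2)]
  obtain f where f: "\<And>z z'. z \<in> lists (alphabet M) \<Longrightarrow> z' \<in> lists (alphabet M) \<Longrightarrow> length z = length z' \<Longrightarrow> f z = f z'"
    and d: "distinguishable (map_pmf (map (observe M)) (run M f a T0))
            (map_pmf (map (observe M)) (run M f b T0))" by blast
  define h where "h n = f (replicate n (observe M a))" for n
  have "replicate n (observe M a) \<in> lists (alphabet M)" for n
    using M ab by (auto simp: po_markov_chain_def)
  then have h: "f z = h (length z)" if "z \<in> lists (alphabet M)" for z
    unfolding h_def using that by (intro f) auto
  define ps where "ps = map (\<lambda>t. t - h (Suc t)) [0..<T0]"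
  obtain t "is" where t: "size t = length ps" "\<forall>i\<in>set is. i \<le> size t"
      "\<And>x. exec (transition M) ps [x] = map_pmf (\<lambda>v. map ((!) (x # v)) is) (samp (transition M) t x)"
    using exec_as_samp[of ps "transition M"] by (auto simp: ps_def)
  have "map_pmf (map (observe M)) (run M f x T0) = map_pmf (\<lambda>z. map ((!) z) is) (?o t x)"
    if "x \<in> states M" for x
  proof -
    have "map_pmf (map (observe M)) (run M f x T0) =
        map_pmf (\<lambda>v. map (observe M) (map ((!) (x # v)) is)) (samp (transition M) t x)"
      using run_eq_exec[OF M that, of f h T0] h by (simp add: ps_def[symmetric] t(3) pmf.map_comp o_def)
    also have "\<dots> = map_pmf (\<lambda>z. map ((!) z) is) (?o t x)"
      unfolding observed_def pmf.map_comp
    proof (rule map_pmf_cong[OF refl])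
      fix v assume v: "v \<in> set_pmf (samp (transition M) t x)"
      have "observe M ((x # v) ! i) = (observe M x # map (observe M) v) ! i" if "i \<in> set is" for i
        using t(2) that length_samp[OF v] nth_map[of i "x # v" "observe M"] by (auto simp: less_Suc_eq_le)
      then show "map (observe M) (map ((!) (x # v)) is) =
          ((\<lambda>z. map ((!) z) is) \<circ> ((#) (observe M x) \<circ> map (observe M))) v" by simp
    qed
    finally show ?thesis .
  qed
  with d ab have "distinguishable (?o t a) (?o t b)" by (auto dest: distinguishable_mapD)
  then show "\<exists>t. size t \<le> T \<and> distinguishable (?o t a) (?o t b)"
    using t(1) T0(1) by (auto simp: ps_def)
next
  assume "\<exists>t. size t \<le> T \<and> distinguishable (?o t a) (?o t b)"
  then obtain t where t: "size t \<le> T" "distinguishable (?o t a) (?o t b)" by blast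
  define ps where "ps = preorder t 0 1"
  \<comment> \<open>With a history of length \<open>n\<close> the time is \<open>n - 1\<close>, and
    rewinding by this amount leads to position \<open>ps ! (n - 1)\<close>.\<close>
  define h where "h n = (n - 1) - ps ! (n - 1)" for n
  \<comment> \<open>Elements of the product space must be \<open>undefined\<close> outside the index
    set; hence \<open>restrict\<close>.\<close>
  define f where "f = restrict (\<lambda>z. h (length z)) (lists (alphabet M))"
  define A where "A = return (strategy_space (alphabet M)) f"
  have f_space: "f \<in> space (strategy_space (alphabet M))"
    by (auto simp: f_def strategy_space_def space_PiM)
  have rw: "rewinding_strategy (alphabet M) A"
    using f_space by (simp add: rewinding_strategy_def A_def prob_space_return)
  \<comment> \<open>Countably many histories make non-adaptivity a measurable condition, so it can
    be checked at the single point \<open>f\<close>.\<close>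
  have "countable (lists (alphabet M))"
    using M by (intro countable_lists countable_finite) (simp add: po_markov_chain_def)
  moreover have "Measurable.pred (strategy_space (alphabet M)) (\<lambda>f. f z = f z')"
    if "z \<in> lists (alphabet M)" "z' \<in> lists (alphabet M)" for z z'
  proof -
    have "(\<lambda>f. f y) \<in> strategy_space (alphabet M) \<rightarrow>\<^sub>M count_space UNIV" if "y \<in> lists (alphabet M)" for y
      unfolding strategy_space_def using that by (rule measurable_component_singleton)
    with that show ?thesis by measurable
  qed
  ultimately have "Measurable.pred (strategy_space (alphabet M))
     (\<lambda>f. \<forall>z\<in>lists (alphabet M). \<forall>z'\<in>lists (alphabet M). length z = length z' \<longrightarrow> f z = f z')"
    unfolding pred_def
    by (intro sets.sets_Collect_countable_All' sets.sets_Collect_imp sets.sets_Collect_const)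
  then have na: "nonadaptive (alphabet M) A"
    unfolding nonadaptive_def A_def by (subst AE_return[OF f_space]) (auto simp: f_def)
  have run: "map_pmf (map (observe M)) (run M f x (size t)) = ?o t x" if "x \<in> states M" for x
  proof -
    have "map (\<lambda>t. t - h (Suc t)) [0..<size t] = ps"
      using preorder_less[of 0 1 _ t] by (intro nth_equalityI) (auto simp: h_def ps_def less_Suc_eq_le)
    then have "run M f x (size t) = exec (transition M) ps [x]"
      using run_eq_exec[OF M that, of f h "size t"] by (simp add: f_def)
    then show ?thesis using exec_preorder[of 0 "[x]" "transition M" t]
      by (simp add: ps_def observed_def pmf.map_comp o_def)
  qed
  define F where "F = {z. z \<in> lists (alphabet M) \<and> length z = Suc (size t)}"
  have finF: "finite F" using M finite_lists_length_eq[of "alphabet M" "Suc (size t)"]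
    by (auto simp: F_def po_markov_chain_def lists_eq_set elim!: rev_finite_subset)
  have "obs_prob M A x (size t) z = pmf (?o t x) z" if "x \<in> states M" for x z
    unfolding obs_prob_def A_def using run[OF that] borel_measurable_pmf_map_run[OF M refl that] f_space
    by (subst integral_return) auto
  then have "obs_tv M A a b (size t) = 1 / 2 * (\<Sum>z\<in>F. \<bar>pmf (?o t a) z - pmf (?o t b) z\<bar>)"
    using ab by (simp add: obs_tv_def F_def)
  moreover have "set_pmf (?o t x) \<subseteq> F" if "x \<in> states M" for x
    using set_map_run[OF M that, of f "size t"] unfolding run[OF that] F_def .
  ultimately have "1 / 3 \<le> obs_tv M A a b (size t)"
    using t(2) distinguishable_iff_half_sum_abs[OF finF] ab by auto
  then have "QC M A a b \<le> enat T" using t(1) by (auto simp: QC_def Inf_enat_le_iff)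
  then show "NAQC M a b \<le> enat T" using rw na by (auto simp: NAQC_def Inf_enat_le_iff)
qed

section \<open>The canonical chain and the lower bound\<close>

lemma observed_Stop [simp]: "observed M Stop x = return_pmf []"
  by (simp add: observed_def)

lemma observed_Query:
  "observed M (Query l r) x = do {y \<leftarrow> transition M x; u \<leftarrow> observed M l y; v \<leftarrow> observed M r x;
     return_pmf (observe M y # u @ v)}"
  by (simp add: observed_def map_pmf_def bind_assoc_pmf bind_return_pmf)

lemma length_observed: "z \<in> set_pmf (observed M t x) \<Longrightarrow> length z = size t"
  by (auto simp: observed_def length_samp)

primrec join :: "qtree \<Rightarrow> qtree \<Rightarrow> qtree" where
  "join Stop t = t"
| "join (Query l r) t = Query l (join r t)"

lemma size_join [simp]: "size (join t t') = size t + size t'"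
  by (induction t) auto

lemma observed_join:
  "observed M (join t t') x = do {u \<leftarrow> observed M t x; v \<leftarrow> observed M t' x; return_pmf (u @ v)}"
  by (induction t) (simp_all add: observed_Query bind_assoc_pmf bind_return_pmf bind_return_pmf')

text \<open>Both parts start at the same state, so its observation \<open>hd z\<close> serves both
  kernels; the fixed length of the first part tells where to cut the rest.\<close>

lemma kernel_join:
  assumes "\<And>y. y \<in> S \<Longrightarrow> L y = bind_pmf (observed M t y) (\<lambda>z. K (observe M y # z))"
    and "\<And>y. y \<in> S \<Longrightarrow> R y = bind_pmf (observed M t' y) (\<lambda>z. K' (observe M y # z))"
  shows "\<exists>K''. \<forall>y\<in>S. do {u \<leftarrow> L y; v \<leftarrow> R y; return_pmf (u @ v)} =
     bind_pmf (observed M (join t t') y) (\<lambda>z. K'' (observe M y # z))"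
proof (intro exI ballI)
  fix y assume y: "y \<in> S"
  let ?K = "\<lambda>z. do {u \<leftarrow> K (hd z # take (size t) (tl z)); v \<leftarrow> K' (hd z # drop (size t) (tl z)); return_pmf (u @ v)}"
  have "do {u \<leftarrow> L y; v \<leftarrow> R y; return_pmf (u @ v)} =
    do {z \<leftarrow> observed M t y; z' \<leftarrow> observed M t' y; u \<leftarrow> K (observe M y # z); v \<leftarrow> K' (observe M y # z'); return_pmf (u @ v)}"
    unfolding assms[OF y] bind_assoc_pmf by (subst (2) bind_commute_pmf) (rule refl)
  also have "\<dots> = do {z \<leftarrow> observed M t y; z' \<leftarrow> observed M t' y; ?K (observe M y # z @ z')}"
    by (intro bind_pmf_cong refl) (auto simp: length_observed)
  finally show "do {u \<leftarrow> L y; v \<leftarrow> R y; return_pmf (u @ v)} =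
      bind_pmf (observed M (join t t') y) (\<lambda>z. ?K (observe M y # z))"
    by (simp add: observed_join bind_assoc_pmf bind_return_pmf)
qed

text \<open>
  \<open>Blk y j i\<close> is position \<open>i\<close> of the block of \<open>y\<close> at scale \<open>j\<close>, where the sinking probability is
  \<open>2^-j\<close>.
\<close>

datatype 's cstate = Sink | Root 's | Blk 's nat nat

text \<open>\<open>idx\<close> numbers the observations and thereby places the leak in a block.
  \<open>scale\<close> is a parameter because its support has to be fitted to the complexities of
  all pairs of states.\<close>

locale canonicalization =
  fixes M :: "('s, 'o) pomc" and idx :: "'o \<Rightarrow> nat" and scale :: "nat pmf"
  assumes chain: "po_markov_chain M"
    and idx: "bij_betw idx (alphabet M) {..<card (alphabet M)}"
    and finite_scale: "finite (set_pmf scale)"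
begin

abbreviation s :: nat where "s \<equiv> card (alphabet M)"

text \<open>The scale is drawn on leaving \<open>Root\<close> and inherited by all later blocks of
  that walk.\<close>

primrec gadget :: "'s cstate \<Rightarrow> 's cstate pmf" where
  "gadget Sink = return_pmf Sink"
| "gadget (Root a) = map_pmf (\<lambda>j. Blk a j 0) scale"
| "gadget (Blk y j i) =
    (if i = 2 * s then map_pmf (\<lambda>y'. Blk y' j 0) (transition M y)
     else map_pmf (\<lambda>b. if b then Sink else Blk y j (Suc i))
            (bernoulli_pmf (if i = s + idx (observe M y) then 1 / 2 ^ j else 0)))"

definition canon :: "('s cstate, nat) pomc" where
  "canon = \<lparr>states = {Sink} \<union> Root ` states M \<union>
              {Blk y j i | y j i. y \<in> states M \<and> j \<in> set_pmf scale \<and> i \<le> 2 * s},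
            transition = gadget, alphabet = {0, 1}, observe = (\<lambda>x. if x = Sink then 1 else 0)\<rparr>"

lemma canon_simps [simp]:
  "transition canon = gadget" "observe canon x = (if x = Sink then 1 else 0)"
  "alphabet canon = {0, 1}"
  by (simp_all add: canon_def)

lemma idx_less: "y \<in> states M \<Longrightarrow> idx (observe M y) < s"
  using idx chain by (auto simp: bij_betw_def po_markov_chain_def)

lemma canonical_canon: "canonical_chain canon"
proof -
  have "states canon = {Sink} \<union> Root ` states M \<union>
      (\<lambda>(y, j, i). Blk y j i) ` (states M \<times> set_pmf scale \<times> {..2 * s})"
    by (auto simp: canon_def image_iff)
  then have "finite (states canon)" using chain finite_scale by (simp add: po_markov_chain_def)
  moreover have "set_pmf (gadget x) \<subseteq> states canon" if "x \<in> states canon" for x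
  proof (cases x)
    case (Blk y j i)
    with that have "y \<in> states M" "j \<in> set_pmf scale" "i \<le> 2 * s" by (auto simp: canon_def)
    moreover from this chain have "set_pmf (transition M y) \<subseteq> states M" by (simp add: po_markov_chain_def)
    ultimately show ?thesis using Blk by (auto simp: canon_def)
  qed (use that in \<open>auto simp: canon_def\<close>)
  ultimately show ?thesis unfolding canonical_chain_def po_markov_chain_def
    by (auto simp: canon_def intro!: bexI[of _ Sink])
qed

lemma observed_Sink: "observed canon t Sink = return_pmf (replicate (size t) 1)"
  by (induction t) (auto simp: observed_Query bind_return_pmf replicate_add)

lemma bernoulli_pmf_0: "bernoulli_pmf 0 = return_pmf False"
  proof (rule pmf_eqI)
  show "pmf (bernoulli_pmf 0) b = pmf (return_pmf False) b" for b by (cases b) auto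
qed

text \<open>Leaks occur only from position \<open>s\<close> on, and so few queries never reach the
  point of querying such a position.\<close>

lemma observed_blind:
  "i + size t \<le> s \<Longrightarrow> observed canon t (Blk y j i) = return_pmf (replicate (size t) 0)"
proof (induction t arbitrary: i)
  case (Query l r)
  then show ?case
    by (auto simp: observed_Query bind_return_pmf bernoulli_pmf_0 replicate_add)
qed simp

text \<open>
  A move to the next block costs a query to \<open>M\<close> only if at least \<open>s\<close> queries follow it. With fewer
  queries it cannot be told apart from a constant.
\<close>

primrec sim :: "qtree \<Rightarrow> nat \<Rightarrow> qtree" where
  "sim Stop i = Stop"
| "sim (Query l r) i =
     join (if i = 2 * s then (if size l < s then Stop else Query (sim l 0) Stop) else sim l (Suc i))
       (sim r i)"

text \<open>Potential argument: a nonempty simulation must first walk the \<open>2 * s - i\<close>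
  steps to the exit of the block, and every simulated query is charged \<open>s\<close>.\<close>

lemma size_sim:
  "i \<le> 2 * s \<Longrightarrow> size (sim t i) = 0 \<or> s * size (sim t i) + (2 * s - i) \<le> size t"
proof (induction t arbitrary: i)
  case (Query l r)
  have r: "s * size (sim r i) \<le> size r" using Query.IH(2)[OF Query.prems] by auto
  show ?case
  proof (cases "i = 2 * s")
    case True
    \<comment> \<open>Either nothing is simulated below and \<open>size l\<close> itself pays
      \<open>s\<close>, or the induction hypothesis leaves a surplus of \<open>2 * s\<close>, half
      of which pays for the move.\<close>
    have "s * size (sim l 0) + s \<le> size l" if "\<not> size l < s"
      using Query.IH(1)[of 0] that by auto
    then show ?thesis using True r by (auto simp: algebra_simps)
  next
    case False
    then have "i < 2 * s" using Query.prems by simp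
    then show ?thesis using False Query.IH(1)[of "Suc i"] Query.IH(2)[of i] by (auto simp: algebra_simps)
  qed
qed simp

text \<open>The point is that \<open>K\<close> is the same for all \<open>y\<close>: the canonical
  chain reveals nothing beyond what the simulating tree sees in \<open>M\<close>.\<close>

lemma observed_Blk_kernel:
  "i \<le> 2 * s \<Longrightarrow> \<exists>K. \<forall>y\<in>states M. observed canon t (Blk y j i) =
     bind_pmf (observed M (sim t i) y) (\<lambda>z. K (observe M y # z))"
proof (induction t arbitrary: i)
  case Stop
  then show ?case by (intro exI[of _ "\<lambda>_. return_pmf []"]) simp
next
  case (Query l r)
  define L where "L y = do {x \<leftarrow> gadget (Blk y j i); u \<leftarrow> observed canon l x; return_pmf (observe canon x # u)}" for y
  obtain Kr where Kr: "\<And>y. y \<in> states M \<Longrightarrow> observed canon r (Blk y j i) =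
      bind_pmf (observed M (sim r i) y) (\<lambda>z. Kr (observe M y # z))"
    using Query.IH(2)[OF Query.prems] by blast
  define lt where "lt = (if i = 2 * s then (if size l < s then Stop else Query (sim l 0) Stop) else sim l (Suc i))"
  have "\<exists>Kl. \<forall>y\<in>states M. L y = bind_pmf (observed M lt y) (\<lambda>z. Kl (observe M y # z))"
  proof -
    consider (skip) "i = 2 * s" "size l < s" | (move) "i = 2 * s" "\<not> size l < s" | (step) "i < 2 * s"
      using Query.prems by linarith
    then show ?thesis
    proof cases
      case skip
      then show ?thesis
        by (intro exI[of _ "\<lambda>_. return_pmf (replicate (Suc (size l)) 0)"])
          (simp add: L_def lt_def bind_map_pmf observed_blind bind_return_pmf)
    next
      case move
      obtain Kl where Kl: "\<And>y. y \<in> states M \<Longrightarrow> observed canon l (Blk y j 0) =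
          bind_pmf (observed M (sim l 0) y) (\<lambda>z. Kl (observe M y # z))"
        using Query.IH(1)[of 0] by auto
      \<comment> \<open>The move does not use the observation of \<open>y\<close>; \<open>tl\<close>
        drops it, and \<open>Kl\<close> then finds that of the successor at the head.\<close>
      have "L y = bind_pmf (observed M lt y) (\<lambda>z. map_pmf (Cons 0) (Kl (tl (observe M y # z))))"
        if y: "y \<in> states M" for y
      proof -
        have "L y = do {y' \<leftarrow> transition M y; u \<leftarrow> observed canon l (Blk y' j 0); return_pmf (0 # u)}"
          using move by (simp add: L_def bind_map_pmf)
        also have "\<dots> = do {y' \<leftarrow> transition M y; z \<leftarrow> observed M (sim l 0) y';
            map_pmf (Cons 0) (Kl (observe M y' # z))}"
          using chain y by (intro bind_pmf_cong refl)
            (auto simp: Kl po_markov_chain_def subset_iff map_pmf_def bind_assoc_pmf)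
        finally show ?thesis using move
          by (simp add: lt_def observed_Query bind_assoc_pmf bind_return_pmf)
      qed
      then show ?thesis by (intro exI[of _ "\<lambda>z. map_pmf (Cons 0) (Kl (tl z))"]) auto
    next
      case step
      obtain Kl where Kl: "\<And>y. y \<in> states M \<Longrightarrow> observed canon l (Blk y j (Suc i)) =
          bind_pmf (observed M (sim l (Suc i)) y) (\<lambda>z. Kl (observe M y # z))"
        using Query.IH(1)[of "Suc i"] step by auto
      \<comment> \<open>The observation of the current state is known as \<open>hd z\<close>, so the
        kernel can toss the coin of the leak itself.\<close>
      define K where "K z = do {b \<leftarrow> bernoulli_pmf (if i = s + idx (hd z) then 1 / 2 ^ j else 0);
         if b then return_pmf (replicate (Suc (size l)) 1) else map_pmf (Cons (0::nat)) (Kl z)}" for z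
      have "L y = bind_pmf (observed M lt y) (\<lambda>z. K (observe M y # z))" if y: "y \<in> states M" for y
      proof -
        let ?q = "if i = s + idx (observe M y) then 1 / 2 ^ j else 0 :: real"
        have "L y = do {b \<leftarrow> bernoulli_pmf ?q; u \<leftarrow> observed canon l (if b then Sink else Blk y j (Suc i));
            return_pmf (observe canon (if b then Sink else Blk y j (Suc i)) # u)}"
          unfolding L_def gadget.simps by (simp only: less_imp_neq[OF step] if_False bind_map_pmf)
        also have "\<dots> = do {b \<leftarrow> bernoulli_pmf ?q; z \<leftarrow> observed M lt y;
            if b then return_pmf (replicate (Suc (size l)) 1) else map_pmf (Cons 0) (Kl (observe M y # z))}"
        proof (intro bind_pmf_cong refl)
          fix b
          show "do {u \<leftarrow> observed canon l (if b then Sink else Blk y j (Suc i));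
              return_pmf (observe canon (if b then Sink else Blk y j (Suc i)) # u)} =
            do {z \<leftarrow> observed M lt y;
              if b then return_pmf (replicate (Suc (size l)) 1) else map_pmf (Cons 0) (Kl (observe M y # z))}"
            using step y
            by (cases b) (simp_all add: Kl lt_def observed_Sink bind_return_pmf map_pmf_def bind_assoc_pmf)
        qed
        also have "\<dots> = bind_pmf (observed M lt y) (\<lambda>z. K (observe M y # z))"
          unfolding K_def list.sel by (rule bind_commute_pmf)
        finally show ?thesis .
      qed
      then show ?thesis by (intro exI[of _ K]) auto
    qed
  qed
  then obtain Kl where Kl: "\<And>y. y \<in> states M \<Longrightarrow> L y = bind_pmf (observed M lt y) (\<lambda>z. Kl (observe M y # z))"
    by auto
  from kernel_join[where L=L and R="\<lambda>y. observed canon r (Blk y j i)", OF Kl Kr]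
  show ?case by (simp add: observed_Query L_def lt_def bind_assoc_pmf bind_return_pmf)
qed

text \<open>\<open>sim\<close> does not depend on the scale, and the scale is independent of the
  hidden states; so one tree serves all scales and the kernel draws \<open>j\<close>.\<close>

lemma observed_Root_kernel:
  "\<exists>t' K. s * size t' \<le> size t \<and> (\<forall>a\<in>states M. observed canon t (Root a) =
     bind_pmf (observed M t' a) (\<lambda>z. K (observe M a # z)))"
proof (induction t)
  case Stop
  then show ?case by (intro exI[of _ Stop] exI[of _ "\<lambda>_. return_pmf []"]) simp
next
  case (Query l r)
  then obtain tr Kr where tr: "s * size tr \<le> size r" and Kr: "\<And>a. a \<in> states M \<Longrightarrow>
      observed canon r (Root a) = bind_pmf (observed M tr a) (\<lambda>z. Kr (observe M a # z))"
    by blast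
  define L where "L a = do {x \<leftarrow> gadget (Root a); u \<leftarrow> observed canon l x; return_pmf (observe canon x # u)}" for a
  have "\<forall>j. \<exists>K. \<forall>y\<in>states M. observed canon l (Blk y j 0) =
     bind_pmf (observed M (sim l 0) y) (\<lambda>z. K (observe M y # z))"
    using observed_Blk_kernel[of 0] by simp
  then obtain Kl where Kl: "\<And>j y. y \<in> states M \<Longrightarrow> observed canon l (Blk y j 0) =
     bind_pmf (observed M (sim l 0) y) (\<lambda>z. Kl j (observe M y # z))" by metis
  define K where "K z = do {j \<leftarrow> scale; map_pmf (Cons (0::nat)) (Kl j z)}" for z
  have "L a = bind_pmf (observed M (sim l 0) a) (\<lambda>z. K (observe M a # z))" if "a \<in> states M" for a
  proof -
    have "L a = do {j \<leftarrow> scale; z \<leftarrow> observed M (sim l 0) a; map_pmf (Cons 0) (Kl j (observe M a # z))}"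
      using that by (simp add: L_def bind_map_pmf Kl map_pmf_def bind_assoc_pmf bind_return_pmf)
    then show ?thesis by (subst (asm) bind_commute_pmf) (simp add: K_def)
  qed
  from kernel_join[where L=L and R="\<lambda>a. observed canon r (Root a)", OF this Kr]
  obtain K' where "\<forall>a\<in>states M. observed canon (Query l r) (Root a) =
     bind_pmf (observed M (join (sim l 0) tr) a) (\<lambda>z. K' (observe M a # z))"
    by (auto simp: observed_Query L_def bind_assoc_pmf bind_return_pmf)
  moreover have "s * size (join (sim l 0) tr) \<le> size (Query l r)"
    using size_sim[of 0 l] tr by (auto simp: algebra_simps)
  ultimately show ?case by blast
qed

lemma NAQC_lower:
  assumes "a \<in> states M" "b \<in> states M"
  shows "enat s * NAQC M a b \<le> NAQC canon (Root a) (Root b)"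
proof (cases "NAQC canon (Root a) (Root b)")
  case (enat T)
  have G: "po_markov_chain canon" using canonical_canon by (simp add: canonical_chain_def)
  have "Root a \<in> states canon" "Root b \<in> states canon" using assms by (auto simp: canon_def)
  from NAQC_le_iff_qtree[OF G this, of T] enat obtain t where t: "size t \<le> T"
    "distinguishable (map_pmf (Cons 0) (observed canon t (Root a))) (map_pmf (Cons 0) (observed canon t (Root b)))"
    by auto
  from observed_Root_kernel[of t] obtain t' K where t': "s * size t' \<le> size t"
    "\<And>a. a \<in> states M \<Longrightarrow> observed canon t (Root a) =
     bind_pmf (map_pmf (Cons (observe M a)) (observed M t' a)) K"
    by (auto simp: bind_map_pmf)
  from t(2) have "distinguishable (map_pmf (Cons (observe M a)) (observed M t' a))
      (map_pmf (Cons (observe M b)) (observed M t' b))"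
    unfolding t'(2)[OF assms(1)] t'(2)[OF assms(2)]
    by (blast dest: distinguishable_mapD distinguishable_bindD)
  then have "NAQC M a b \<le> enat (size t')" using NAQC_le_iff_qtree[OF chain assms] by blast
  then have "enat s * NAQC M a b \<le> enat s * enat (size t')" by (rule mult_left_mono) simp
  also have "\<dots> \<le> enat T" using t(1) t'(1) by simp
  finally show ?thesis using enat by simp
qed simp

end

section \<open>The upper bound\<close>

primrec stem :: "nat \<Rightarrow> qtree \<Rightarrow> qtree" where
  "stem 0 t = t"
| "stem (Suc n) t = Query (stem n t) Stop"

lemma size_stem [simp]: "size (stem n t) = n + size t"
  by (induction n) auto

lemma stem_add: "stem (m + n) t = stem m (stem n t)"
  by (induction m) auto

lemma observed_stem_Suc:
  "observed M (stem (Suc n) t) x = do {y \<leftarrow> transition M x; map_pmf (Cons (observe M y)) (observed M (stem n t) y)}"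
  by (simp add: observed_Query map_pmf_def bind_return_pmf)

lemma finite_set_observed:
  assumes "po_markov_chain M" "x \<in> states M"
  shows "finite (set_pmf (observed M t x))"
  using assms(2)
proof (induction t arbitrary: x)
  case (Query l r)
  have sub: "set_pmf (transition M x) \<subseteq> states M" "finite (states M)"
    using assms(1) Query.prems by (auto simp: po_markov_chain_def)
  then have "finite (set_pmf (transition M x))" by (rule finite_subset)
  then show ?case using Query sub by (auto simp: observed_Query)
qed simp

primrec copies :: "nat \<Rightarrow> qtree \<Rightarrow> qtree" where
  "copies 0 t = Stop"
| "copies (Suc n) t = Query t (copies n t)"

lemma size_copies: "size (copies n t) = n * Suc (size t)"
  by (induction n) auto

primrec decode_copies :: "('a list \<Rightarrow> 'b) \<Rightarrow> nat \<Rightarrow> nat \<Rightarrow> 'a list \<Rightarrow> 'b list" where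
  "decode_copies d m 0 z = []"
| "decode_copies d m (Suc n) z = d (take m (drop 1 z)) # decode_copies d m n (drop (Suc m) z)"

text \<open>Each copy makes its own query to \<open>x\<close>, so the copies are independent; at a
  \<open>Root\<close> state each of them draws a fresh scale.\<close>

lemma decode_copies_observed:
  "map_pmf (decode_copies d (size t) n) (observed M (copies n t) x) =
     replicate_pmf n (do {y \<leftarrow> transition M x; map_pmf d (observed M t y)})"
proof (induction n)
  case (Suc n)
  have "map_pmf (decode_copies d (size t) (Suc n)) (observed M (copies (Suc n) t) x) =
     do {y \<leftarrow> transition M x; u \<leftarrow> observed M t y; v \<leftarrow> observed M (copies n t) x;
       return_pmf (d u # decode_copies d (size t) n v)}"
    by (auto simp: observed_Query map_bind_pmf length_observed intro!: bind_pmf_cong)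
  also have "\<dots> = do {w \<leftarrow> do {y \<leftarrow> transition M x; map_pmf d (observed M t y)};
      ws \<leftarrow> map_pmf (decode_copies d (size t) n) (observed M (copies n t) x); return_pmf (w # ws)}"
    by (simp add: bind_assoc_pmf bind_map_pmf)
  finally show ?case unfolding Suc replicate_pmf.simps .
qed simp

section \<open>Reading off the observation of a block\<close>

context canonicalization
begin

definition sink_prob :: "nat \<Rightarrow> real" where "sink_prob j = 1 / 2 ^ j"

lemma sink_prob: "0 \<le> sink_prob j" "sink_prob j \<le> 1"
  by (simp_all add: sink_prob_def)

lemma observed_walk:
  assumes "\<And>k. k < n \<Longrightarrow> i + k \<noteq> s + idx (observe M y)" "i + n \<le> 2 * s"
  shows "observed canon (stem n t) (Blk y j i) =
    map_pmf ((@) (replicate n 0)) (observed canon t (Blk y j (i + n)))"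
  using assms
proof (induction n arbitrary: i)
  case (Suc n)
  have "observed canon (stem (Suc n) t) (Blk y j i) = map_pmf (Cons 0) (observed canon (stem n t) (Blk y j (Suc i)))"
    using Suc.prems(1)[of 0] Suc.prems(2)
    unfolding observed_stem_Suc by (simp add: bernoulli_pmf_0 bind_return_pmf)
  also have "\<dots> = map_pmf (Cons 0) (map_pmf ((@) (replicate n 0)) (observed canon t (Blk y j (Suc i + n))))"
    using Suc.prems(1)[of "Suc _"] Suc.prems(2) by (subst Suc.IH) auto
  finally show ?case by (simp add: pmf.map_comp o_def)
qed (simp add: map_pmf_def bind_return_pmf')

text \<open>The leak happens on the step that leaves position \<open>s + idx (observe M y)\<close>,
  after that many zeros; all later queries see the sink.\<close>

lemma observed_block:
  assumes y: "y \<in> states M"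
  shows "observed canon (stem (2 * s) t) (Blk y j 0) = do {b \<leftarrow> bernoulli_pmf (sink_prob j);
    if b then return_pmf (replicate (s + idx (observe M y)) 0 @ replicate (s - idx (observe M y) + size t) 1)
    else map_pmf ((@) (replicate (2 * s) 0)) (observed canon t (Blk y j (2 * s)))}"
proof -
  define k where "k = idx (observe M y)"
  have k: "k < s" using idx_less[OF y] by (simp add: k_def)
  then obtain d where d: "s = Suc (k + d)" using less_iff_Suc_add by blast
  let ?t = "stem d t"
  \<comment> \<open>\<open>s + k\<close> safe steps, the step that may leak, and \<open>d\<close>
    safe steps.\<close>
  have split: "2 * s = (s + k) + Suc d" using d by simp
  have "observed canon (stem (2 * s) t) (Blk y j 0) =
      map_pmf ((@) (replicate (s + k) 0)) (observed canon (stem (Suc d) t) (Blk y j (s + k)))"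
    unfolding split stem_add[of "s + k" "Suc d"]
    using observed_walk[of "s + k" 0 y "stem (Suc d) t" j] k by (simp add: k_def)
  also have "observed canon (stem (Suc d) t) (Blk y j (s + k)) = do {b \<leftarrow> bernoulli_pmf (sink_prob j);
      if b then return_pmf (replicate (s - k + size t) 1)
      else map_pmf ((@) (replicate (Suc d) 0)) (observed canon t (Blk y j (2 * s)))}"
  proof -
    have "observed canon (stem (Suc d) t) (Blk y j (s + k)) = do {b \<leftarrow> bernoulli_pmf (sink_prob j);
        map_pmf (Cons (observe canon (if b then Sink else Blk y j (Suc (s + k)))))
          (observed canon ?t (if b then Sink else Blk y j (Suc (s + k))))}"
      using k unfolding observed_stem_Suc
      by (simp add: bind_map_pmf k_def[symmetric] sink_prob_def del: canon_simps(2) split del: if_split)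
    also have "\<dots> = do {b \<leftarrow> bernoulli_pmf (sink_prob j);
      if b then return_pmf (replicate (s - k + size t) 1)
      else map_pmf ((@) (replicate (Suc d) 0)) (observed canon t (Blk y j (2 * s)))}"
    proof (intro bind_pmf_cong refl)
      fix b
      have eq: "Suc (s + k) + d = 2 * s" "s - k = Suc d" using split d by auto
      have "observed canon ?t (Blk y j (Suc (s + k))) =
          map_pmf ((@) (replicate d 0)) (observed canon t (Blk y j (2 * s)))"
        unfolding eq(1)[symmetric] using split by (intro observed_walk) (auto simp: k_def)
      then show "map_pmf (Cons (observe canon (if b then Sink else Blk y j (Suc (s + k)))))
          (observed canon ?t (if b then Sink else Blk y j (Suc (s + k)))) =
         (if b then return_pmf (replicate (s - k + size t) 1)
          else map_pmf ((@) (replicate (Suc d) 0)) (observed canon t (Blk y j (2 * s))))"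
        using eq(2) by (cases b) (auto simp: observed_Sink pmf.map_comp intro!: map_pmf_cong)
    qed
    finally show ?thesis .
  qed
  finally have *: "observed canon (stem (2 * s) t) (Blk y j 0) = do {b \<leftarrow> bernoulli_pmf (sink_prob j);
      map_pmf ((@) (replicate (s + k) 0)) (if b then return_pmf (replicate (s - k + size t) 1)
        else map_pmf ((@) (replicate (Suc d) 0)) (observed canon t (Blk y j (2 * s))))}"
    unfolding map_bind_pmf .
  have r: "replicate (2 * s) (0 :: nat) = replicate (s + k) 0 @ replicate (Suc d) 0"
    by (simp only: split replicate_add append_assoc)
  show ?thesis unfolding * k_def[symmetric] r
  proof (intro bind_pmf_cong refl)
    show "map_pmf ((@) (replicate (s + k) 0)) (if b then return_pmf (replicate (s - k + size t) 1)
        else map_pmf ((@) (replicate (Suc d) 0)) (observed canon t (Blk y j (2 * s)))) =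
      (if b then return_pmf (replicate (s + k) 0 @ replicate (s - k + size t) 1)
        else map_pmf ((@) (replicate (s + k) 0 @ replicate (Suc d) 0)) (observed canon t (Blk y j (2 * s))))" for b
      by (cases b) (auto simp: pmf.map_comp simp del: replicate_Suc intro!: map_pmf_cong)
  qed
qed

text \<open>
  A trial that starts in a living block shows \<open>s + idx x\<close> zeros if it reads off the observation
  \<open>x\<close> and \<open>2 * s\<close> zeros if it fails; a trial that starts in the sink shows none.
\<close>

definition decode_trial :: "nat list \<Rightarrow> 'o option" where
  "decode_trial v = (let n = length (filter ((=) 0) v) in
     if s \<le> n \<and> n < 2 * s then Some (inv_into (alphabet M) idx (n - s)) else None)"

primrec trials :: "nat \<Rightarrow> qtree" where
  "trials 0 = Stop"
| "trials (Suc R) = join (stem (2 * s) Stop) (trials R)"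

primrec decode_trials :: "nat \<Rightarrow> nat list \<Rightarrow> 'o option" where
  "decode_trials 0 z = None"
| "decode_trials (Suc R) z = (case decode_trial (take (2 * s) z) of
     Some x \<Rightarrow> Some x | None \<Rightarrow> decode_trials R (drop (2 * s) z))"

lemma size_trials [simp]: "size (trials R) = R * (2 * s)"
  by (induction R) auto

lemma decode_trial_block:
  assumes y: "y \<in> states M"
  shows "map_pmf decode_trial (observed canon (stem (2 * s) Stop) (Blk y j 0)) =
    map_pmf (\<lambda>b. if b then Some (observe M y) else None) (bernoulli_pmf (sink_prob j))"
proof -
  have "inv_into (alphabet M) idx (idx (observe M y)) = observe M y"
    using idx chain y by (intro inv_into_f_f) (auto simp: bij_betw_def po_markov_chain_def)
  then have "decode_trial (replicate (s + idx (observe M y)) 0 @ replicate (s - idx (observe M y)) 1) = Some (observe M y)"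
    using idx_less[OF y] by (simp add: decode_trial_def filter_replicate)
  moreover have "decode_trial (replicate (2 * s) 0) = None"
    by (simp add: decode_trial_def)
  ultimately show ?thesis
    unfolding observed_block[OF y] map_bind_pmf
    by (subst map_pmf_def) (auto intro!: bind_pmf_cong)
qed

text \<open>The trials are independent and every successful one yields the same symbol, so only the
  event that some trial succeeds matters.\<close>

lemma decode_trials_block:
  assumes y: "y \<in> states M"
  shows "map_pmf (decode_trials R) (observed canon (trials R) (Blk y j 0)) =
    map_pmf (\<lambda>b. if b then Some (observe M y) else None) (bernoulli_pmf (1 - (1 - sink_prob j) ^ R))"
proof (induction R)
  case 0
  then show ?case by (simp add: bernoulli_pmf_0)
next
  case (Suc R)
  let ?o = "\<lambda>b. if b then Some (observe M y) else None"
  let ?x = "Blk y j 0" and ?q = "1 - (1 - sink_prob j) ^ R"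
  have q: "0 \<le> ?q" "?q \<le> 1" using sink_prob[of j] by (auto simp: power_le_one)
  have "map_pmf (decode_trials (Suc R)) (observed canon (trials (Suc R)) ?x) =
      do {u \<leftarrow> observed canon (stem (2 * s) Stop) ?x; v \<leftarrow> observed canon (trials R) ?x;
        return_pmf (case decode_trial u of Some x \<Rightarrow> Some x | None \<Rightarrow> decode_trials R v)}"
    by (auto simp: observed_join map_bind_pmf length_observed intro!: bind_pmf_cong split: option.split)
  also have "\<dots> = do {A \<leftarrow> map_pmf decode_trial (observed canon (stem (2 * s) Stop) ?x);
       B \<leftarrow> map_pmf (decode_trials R) (observed canon (trials R) ?x);
       return_pmf (case A of Some x \<Rightarrow> Some x | None \<Rightarrow> B)}"
    by (simp add: bind_map_pmf)
  also have "\<dots> = map_pmf ?o (do {b \<leftarrow> bernoulli_pmf (sink_prob j); b' \<leftarrow> bernoulli_pmf ?q; return_pmf (b \<or> b')})"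
    unfolding Suc decode_trial_block[OF y] bind_map_pmf map_bind_pmf
    by (auto intro!: bind_pmf_cong split: option.split)
  also have "\<dots> = map_pmf ?o (bernoulli_pmf (1 - (1 - sink_prob j) ^ Suc R))"
    using sink_prob[of j] q by (subst bernoulli_or) simp_all
  finally show ?case .
qed

lemma decode_trials_dead: "states M \<noteq> {} \<Longrightarrow> decode_trials R (replicate n 1) = None"
proof (induction R arbitrary: n)
  case (Suc R)
  then have "s \<noteq> 0" using chain by (auto simp: po_markov_chain_def)
  then show ?case using Suc by (simp add: decode_trial_def min_def)
qed simp

text \<open>Each list of siblings ends in one \<open>Stop\<close>, where the trials are run. Thus
  every visited state, the root included, is read off exactly once.\<close>

primrec enc :: "nat \<Rightarrow> qtree \<Rightarrow> qtree" where
  "enc R Stop = trials R"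
| "enc R (Query l r) = join (stem (2 * s) (stem 1 (enc R l))) (enc R r)"

lemma size_enc: "size (enc R t) = size t * Suc (2 * s) + Suc (size t) * (R * (2 * s))"
  by (induction t) (auto simp: algebra_simps)

text \<open>\<open>x\<close> is the observation of the current state, found in the part for
  \<open>r\<close>; \<open>u\<close> begins with the observation of the child.\<close>

fun merge :: "'b list option \<Rightarrow> 'b list option \<Rightarrow> 'b list option" where
  "merge (Some u) (Some (x # v)) = Some (x # u @ v)"
| "merge _ _ = None"

lemma merge_None [simp]: "merge A None = None"
  by (cases A) auto

primrec decode :: "nat \<Rightarrow> qtree \<Rightarrow> nat list \<Rightarrow> 'o list option" where
  "decode R Stop z = map_option (\<lambda>x. [x]) (decode_trials R z)"
| "decode R (Query l r) z =
     merge (decode R l (take (size (enc R l)) (drop (2 * s + 1) z)))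
           (decode R r (drop (2 * s + 1 + size (enc R l)) z))"

lemma decode_dead: "states M \<noteq> {} \<Longrightarrow> decode R t (replicate n 1) = None"
  by (induction t arbitrary: n) (simp_all add: decode_trials_dead del: One_nat_def)

text \<open>\<open>n\<close> traversals must not sink, and \<open>Suc n\<close> states, the root
  included, must be read off.\<close>

definition success_prob :: "nat \<Rightarrow> nat \<Rightarrow> nat \<Rightarrow> real" where
  "success_prob R n j = (1 - sink_prob j) ^ n * (1 - (1 - sink_prob j) ^ R) ^ Suc n"

lemma success_prob_bounds: "0 \<le> success_prob R n j" "success_prob R n j \<le> 1"
  using sink_prob[of j] by (auto simp: success_prob_def power_le_one mult_le_one simp del: power_Suc)

text \<open>All blocks of one scale leak with the same probability, whatever their observation; so
  survival is independent of the hidden states, and the erasures compose along the tree.\<close>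

lemma decode_block:
  "y \<in> states M \<Longrightarrow> map_pmf (decode R t) (observed canon (enc R t) (Blk y j 0)) =
     erase (success_prob R (size t) j) (map_pmf (Cons (observe M y)) (observed M t y))"
proof (induction t arbitrary: y)
  case Stop
  have "map_pmf (decode R Stop) (observed canon (enc R Stop) (Blk y j 0)) =
     map_pmf (map_option (\<lambda>x. [x])) (map_pmf (decode_trials R) (observed canon (trials R) (Blk y j 0)))"
    by (auto simp: pmf.map_comp intro!: map_pmf_cong)
  also have "\<dots> = erase (success_prob R 0 j) (return_pmf [observe M y])"
    unfolding decode_trials_block[OF Stop] pmf.map_comp erase_def
    by (subst map_pmf_def) (auto simp: success_prob_def intro!: bind_pmf_cong)
  finally show ?case by (simp only: observed_Stop map_return_pmf qtree.size)
next
  case (Query l r)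
  let ?x = "Blk y j 0" and ?t = "stem 1 (enc R l)"
  let ?p = "do {y' \<leftarrow> transition M y; map_pmf (Cons (observe M y')) (observed M l y')}"
  have states: "states M \<noteq> {}" using Query.prems by auto
  have "map_pmf (decode R (Query l r)) (observed canon (enc R (Query l r)) ?x) =
      do {u \<leftarrow> observed canon (stem (2 * s) ?t) ?x; v \<leftarrow> observed canon (enc R r) ?x;
        return_pmf (merge (decode R l (drop (2 * s + 1) u)) (decode R r v))}"
    unfolding enc.simps observed_join map_bind_pmf map_return_pmf
    by (intro bind_pmf_cong refl) (simp add: length_observed)
  also have "\<dots> = do {A \<leftarrow> map_pmf (\<lambda>u. decode R l (drop (2 * s + 1) u)) (observed canon (stem (2 * s) ?t) ?x);
      B \<leftarrow> map_pmf (decode R r) (observed canon (enc R r) ?x); return_pmf (merge A B)}"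
    unfolding bind_map_pmf ..
  also have "map_pmf (\<lambda>u. decode R l (drop (2 * s + 1) u)) (observed canon (stem (2 * s) ?t) ?x) =
      do {b \<leftarrow> bernoulli_pmf (sink_prob j); if b then return_pmf None else erase (success_prob R (size l) j) ?p}"
    unfolding observed_block[OF Query.prems] map_bind_pmf
  proof (intro bind_pmf_cong refl)
    fix b
    have "drop m (replicate k 0 @ replicate k' (1::nat)) = replicate (k' - (m - k)) 1" if "k \<le> m" for m k k'
      using that by simp
    \<comment> \<open>A sunk traversal shows fewer than \<open>2 * s\<close> zeros, so
      \<open>decode R l\<close> receives only ones.\<close>
    then have dead: "decode R l (drop (2 * s + 1) (replicate (s + idx (observe M y)) 0 @ replicate k' 1)) = None" for k'
      using idx_less[OF Query.prems] by (simp add: decode_dead[OF states] del: drop_append One_nat_def)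
    have "map_pmf (\<lambda>u. decode R l (drop (2 * s + 1) u))
        (map_pmf ((@) (replicate (2 * s) 0)) (observed canon ?t (Blk y j (2 * s)))) =
        map_pmf (\<lambda>u. decode R l (drop 1 u)) (observed canon ?t (Blk y j (2 * s)))"
      by (simp add: pmf.map_comp o_def)
    also have "\<dots> = do {y' \<leftarrow> transition M y; map_pmf (decode R l) (observed canon (enc R l) (Blk y' j 0))}"
      unfolding One_nat_def observed_stem_Suc by (simp add: map_bind_pmf bind_map_pmf pmf.map_comp o_def)
    also have "\<dots> = do {y' \<leftarrow> transition M y; erase (success_prob R (size l) j) (map_pmf (Cons (observe M y')) (observed M l y'))}"
      using chain Query.prems by (intro bind_pmf_cong refl Query.IH(1)) (auto simp: po_markov_chain_def)
    also have "\<dots> = erase (success_prob R (size l) j) ?p" by (rule bind_erase)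
    finally show "map_pmf (\<lambda>u. decode R l (drop (2 * s + 1) u))
       (if b then return_pmf (replicate (s + idx (observe M y)) 0 @
           replicate (s - idx (observe M y) + size ?t) 1)
        else map_pmf ((@) (replicate (2 * s) 0)) (observed canon ?t (Blk y j (2 * s)))) =
       (if b then return_pmf None else erase (success_prob R (size l) j) ?p)"
      by (cases b) (simp_all only: dead if_True if_False map_return_pmf)
  qed
  also have "\<dots> = erase ((1 - sink_prob j) * success_prob R (size l) j) ?p"
    by (intro erase_failure sink_prob success_prob_bounds)
  \<comment> \<open>\<open>v\<close> is never empty on its support, so \<open>merge\<close> acts on
    survivors as \<open>hd v # u @ tl v\<close>.\<close>
  also have "do {A \<leftarrow> \<dots>; B \<leftarrow> map_pmf (decode R r) (observed canon (enc R r) ?x); return_pmf (merge A B)} =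
      erase ((1 - sink_prob j) * success_prob R (size l) j * success_prob R (size r) j)
        (do {u \<leftarrow> ?p; v \<leftarrow> map_pmf (Cons (observe M y)) (observed M r y); return_pmf (hd v # u @ tl v)})"
    unfolding Query.IH(2)[OF Query.prems]
    using sink_prob[of j] success_prob_bounds[of R _ j]
    by (intro erase_product) (auto simp: mult_le_one)
  also have "(1 - sink_prob j) * success_prob R (size l) j * success_prob R (size r) j =
      success_prob R (size (Query l r)) j"
    by (simp add: success_prob_def power_add)
  also have "do {u \<leftarrow> ?p; v \<leftarrow> map_pmf (Cons (observe M y)) (observed M r y); return_pmf (hd v # u @ tl v)} =
      map_pmf (Cons (observe M y)) (observed M (Query l r) y)"
    by (simp add: observed_Query map_bind_pmf bind_map_pmf bind_assoc_pmf)
  finally show ?case .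
qed

text \<open>Two events of probability at least 1/2 each, by Bernoulli's inequality: no traversal
  sinks, as \<open>n * sink_prob j\<close> is at most 1/2, and no block stays unread.\<close>

lemma success_prob_ge:
  assumes "1 \<le> n" "m \<le> n" "2 * n \<le> 2 ^ j"
  shows "1 / 4 \<le> success_prob (2 ^ j * Suc j) m j"
proof -
  let ?q = "sink_prob j"
  have "2 * real n \<le> 2 ^ j" using assms(3) by (metis of_nat_le_iff of_nat_mult of_nat_numeral of_nat_power)
  then have q: "2 * real n * ?q \<le> 1" by (simp add: sink_prob_def field_simps)
  have "real m * ?q \<le> real n * ?q" using assms sink_prob[of j] by (intro mult_right_mono) auto
  then have "1 / 2 \<le> 1 + real m * (- ?q)" using q by simp
  also have "\<dots> \<le> (1 + - ?q) ^ m" using sink_prob[of j] by (intro Bernoulli_inequality) simp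
  finally have survive: "1 / 2 \<le> (1 - ?q) ^ m" by simp
  define e where "e = (1 - ?q) ^ (2 ^ j * Suc j)"
  have "(1 - ?q) ^ 2 ^ j \<le> exp (- ?q) ^ 2 ^ j"
    using sink_prob[of j] exp_ge_add_one_self[of "- ?q"] by (intro power_mono) auto
  also have "\<dots> = exp (- 1)"
    by (simp add: exp_of_nat_mult[symmetric] sink_prob_def)
  also have "\<dots> \<le> 1 / 2" using exp_ge_add_one_self[of 1] by (simp add: exp_minus field_simps)
  \<comment> \<open>A round of \<open>2 ^ j\<close> trials fails with probability at most 1/2;
    \<open>Suc j\<close> rounds bring this down to \<open>?q / 2\<close>.\<close>
  finally have "e \<le> (1 / 2) ^ Suc j"
    unfolding e_def power_mult using sink_prob[of j] by (intro power_mono) auto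
  then have e: "0 \<le> e" "e \<le> 1" "e \<le> ?q / 2"
    using sink_prob[of j] by (auto simp: e_def sink_prob_def power_divide power_le_one)
  have "real (Suc m) * e \<le> (2 * real n) * (?q / 2)" using e assms by (intro mult_mono) auto
  then have "1 / 2 \<le> 1 + real (Suc m) * (- e)" using q by simp
  also have "\<dots> \<le> (1 + - e) ^ Suc m" using e by (intro Bernoulli_inequality) simp
  finally have "1 / 2 \<le> (1 - e) ^ Suc m" by simp
  with survive have "1 / 2 * (1 / 2) \<le> (1 - ?q) ^ m * (1 - e) ^ Suc m"
    using sink_prob[of j] by (intro mult_mono) auto
  then show ?thesis by (simp add: success_prob_def e_def)
qed

text \<open>Order \<open>j^2\<close> copies, order \<open>n\<close> states to be read off in each,
  order \<open>n * j\<close> trials per state and \<open>2 * s\<close> queries per trial multiply to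
  the bound.\<close>

lemma NAQC_upper:
  assumes ab: "a \<in> states M" "b \<in> states M"
    and naqc: "NAQC M a b \<le> enat n" and n: "1 \<le> n" "2 * n \<le> 2 ^ j" "2 ^ j \<le> 4 * n"
    and scale: "1 / (real (Suc j) * real (Suc (Suc j))) \<le> pmf scale j"
  shows "NAQC canon (Root a) (Root b) \<le> enat (1280 * s * n\<^sup>2 * (j + 2) ^ 3)"
proof -
  obtain t where t: "size t \<le> n" "distinguishable (map_pmf (Cons (observe M a)) (observed M t a))
      (map_pmf (Cons (observe M b)) (observed M t b))"
    using naqc NAQC_le_iff_qtree[OF chain ab] by blast
  define p where "p x = map_pmf (Cons (observe M x)) (observed M t x)" for x
  have fin: "finite (set_pmf (p x))" if "x \<in> states M" for x
    using finite_set_observed[OF chain that] by (simp add: p_def)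
  define R where "R = 2 ^ j * Suc j"
  \<comment> \<open>The mean survival probability \<open>c\<close> will be at least
    \<open>1 / (4 * (j + 1) * (j + 2))\<close>, so \<open>K * c\<close> is at least 10.\<close>
  define K where "K = 40 * Suc j * Suc (Suc j)"
  define T where "T = copies K (enc R t)"
  define c where "c = measure_pmf.expectation scale (success_prob R (size t))"
  have "c = (\<Sum>i\<in>set_pmf scale. success_prob R (size t) i * pmf scale i)"
    unfolding c_def using finite_scale by (intro integral_measure_pmf_real) auto
  moreover have "j \<in> set_pmf scale"
  proof -
    have "0 < 1 / (real (Suc j) * real (Suc (Suc j)))" by simp
    also note scale
    finally show ?thesis by (simp add: set_pmf_iff)
  qed
  \<comment> \<open>The right scale alone gives this; the other scales add nonnegative
    terms.\<close>
  ultimately have "success_prob R (size t) j * pmf scale j \<le> c"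
    using finite_scale success_prob_bounds
    by (auto intro!: member_le_sum[of j _ "\<lambda>i. success_prob R (size t) i * pmf scale i"])
  moreover have "1 / 4 * (1 / (real (Suc j) * real (Suc (Suc j)))) \<le> success_prob R (size t) j * pmf scale j"
    using success_prob_ge[OF n(1) t(1) n(2)] scale success_prob_bounds
    unfolding R_def by (intro mult_mono) auto
  ultimately have "1 / 4 * (1 / (real (Suc j) * real (Suc (Suc j)))) \<le> c" by (rule order_trans[rotated])
  then have "real K * (1 / 4 * (1 / (real (Suc j) * real (Suc (Suc j))))) \<le> real K * c"
    by (rule mult_left_mono) simp
  moreover have "real K = 40 * (real (Suc j) * real (Suc (Suc j)))"
    by (simp only: K_def of_nat_mult of_nat_numeral mult.assoc)
  ultimately have Kc: "10 \<le> real K * c" by simp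
  have c: "0 \<le> c" "c \<le> 1"
    unfolding c_def using success_prob_bounds finite_scale
    by (auto intro!: integral_nonneg measure_pmf.integral_le_const integrable_measure_pmf_finite)
  have law: "map_pmf (decode_copies (decode R t) (size (enc R t)) K) (observed canon T (Root x)) =
      replicate_pmf K (erase c (p x))" if "x \<in> states M" for x
    unfolding T_def decode_copies_observed c_def
    using decode_block[OF that, of R t] erase_mixture[of scale "success_prob R (size t)" "p x", OF finite_scale success_prob_bounds]
    by (simp add: bind_map_pmf p_def)
  have fin_erase: "finite (set_pmf (erase c (p x)))" if "x \<in> states M" for x
    by (rule finite_subset[OF set_erase]) (simp add: fin[OF that])
  have "bhattacharyya (erase c (p a)) (erase c (p b)) = (1 - c) + c * bhattacharyya (p a) (p b)"
    using c fin[OF ab(1)] by (rule bhattacharyya_erase)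
  also have "\<dots> \<le> (1 - c) + c * (19 / 20)"
    using t(2) c(1) unfolding p_def[symmetric]
    by (intro add_left_mono mult_left_mono bhattacharyya_le_if_distinguishable fin ab) auto
  \<comment> \<open>The exponential form makes the power explicit: \<open>K\<close> copies bring the
    coefficient down to \<open>exp (- 1 / 2)\<close>, which is below 2/3.\<close>
  also have "\<dots> \<le> exp (- c / 20)" using exp_ge_add_one_self[of "- c / 20"] by simp
  finally have "bhattacharyya (erase c (p a)) (erase c (p b)) ^ K \<le> exp (- c / 20) ^ K"
    by (intro power_mono) (auto simp: bhattacharyya_def intro: sum_nonneg)
  also have "\<dots> = exp (- (real K * c) / 20)" by (simp add: exp_of_nat_mult[symmetric])
  also have "\<dots> \<le> exp (- 1 / 2)" using Kc by simp
  also have "\<dots> \<le> 2 / 3" using exp_ge_add_one_self[of "1 / 2"] by (simp add: exp_minus field_simps)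
  finally have "distinguishable (replicate_pmf K (erase c (p a))) (replicate_pmf K (erase c (p b)))"
    using ab fin_erase
    by (intro distinguishable_if_bhattacharyya_le)
      (auto simp: bhattacharyya_replicate set_replicate_pmf lists_eq_set intro: finite_lists_length_eq)
  then have "distinguishable (observed canon T (Root a)) (observed canon T (Root b))"
    unfolding law[OF ab(1), symmetric] law[OF ab(2), symmetric] by (rule distinguishable_mapD)
  then have "distinguishable (map_pmf tl (map_pmf (Cons 0) (observed canon T (Root a))))
      (map_pmf tl (map_pmf (Cons 0) (observed canon T (Root b))))"
    by (simp add: pmf.map_comp o_def)
  then have "distinguishable (map_pmf (Cons 0) (observed canon T (Root a))) (map_pmf (Cons 0) (observed canon T (Root b)))"
    by (rule distinguishable_mapD)
  moreover have "po_markov_chain canon" "Root a \<in> states canon" "Root b \<in> states canon"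
    using canonical_canon ab by (auto simp: canonical_chain_def canon_def)
  ultimately have "NAQC canon (Root a) (Root b) \<le> enat (size T)"
    by (subst NAQC_le_iff_qtree) (auto intro!: exI[of _ T])
  also have "size T \<le> 1280 * s * n\<^sup>2 * (j + 2) ^ 3"
  proof -
    have s: "1 \<le> s" using idx_less[OF ab(1)] by simp
    have R: "1 \<le> R" "R \<le> 4 * n * (j + 1)"
      using mult_right_mono[OF n(3), of "Suc j"] by (simp_all add: R_def Suc_le_eq)
    have snR: "1 \<le> s * n * R" "s * n \<le> s * n * R" using s n(1) R by auto
    have "size (enc R t) \<le> n * Suc (2 * s) + Suc n * (R * (2 * s))"
      unfolding size_enc using t(1) by (intro add_mono mult_right_mono) auto
    also have "\<dots> \<le> n * (3 * s) + (2 * n) * (R * (2 * s))"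
      using s n(1) by (intro add_mono mult_mono) auto
    also have "\<dots> \<le> 7 * (s * n * R)" using snR(2) by (simp add: algebra_simps)
    finally have "Suc (size (enc R t)) \<le> 8 * (s * n * R)" using snR(1) by linarith
    also have "\<dots> \<le> 8 * (s * n * (4 * n * (j + 1)))" using R(2) by simp
    finally have "size T \<le> K * (8 * (s * n * (4 * n * (j + 1))))"
      unfolding T_def size_copies by (rule mult_left_mono) simp
    \<comment> \<open>\<open>1280 = 40 * 8 * 4\<close>.\<close>
    also have "\<dots> = 1280 * s * n\<^sup>2 * ((j + 1) * (j + 2) * (j + 1))"
      by (simp add: K_def power2_eq_square algebra_simps)
    also have "\<dots> \<le> 1280 * s * n\<^sup>2 * (j + 2) ^ 3"
      unfolding power3_eq_cube by (intro mult_mono) auto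
    finally show ?thesis .
  qed
  finally show ?thesis by simp
qed

end

section \<open>Natural numbers as states\<close>

definition relabel :: "('s \<Rightarrow> 't) \<Rightarrow> ('s, 'o) pomc \<Rightarrow> ('t, 'o) pomc" where
  "relabel h M = \<lparr>states = h ` states M,
     transition = (\<lambda>n. map_pmf h (transition M (inv_into (states M) h n))),
     alphabet = alphabet M, observe = (\<lambda>n. observe M (inv_into (states M) h n))\<rparr>"

context
  fixes M :: "('s, 'o) pomc" and h :: "'s \<Rightarrow> 't"
  assumes M: "po_markov_chain M" and h: "inj_on h (states M)"
begin

lemma relabel_simps:
  "states (relabel h M) = h ` states M" "alphabet (relabel h M) = alphabet M"
  "x \<in> states M \<Longrightarrow> transition (relabel h M) (h x) = map_pmf h (transition M x)"
  "x \<in> states M \<Longrightarrow> observe (relabel h M) (h x) = observe M x"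
  using h by (simp_all add: relabel_def)

lemma po_markov_chain_relabel: "po_markov_chain (relabel h M)"
  using M by (fastforce simp: po_markov_chain_def relabel_simps)

lemma observed_relabel: "x \<in> states M \<Longrightarrow> observed (relabel h M) t (h x) = observed M t x"
proof (induction t arbitrary: x)
  case (Query l r)
  have "y \<in> states M" if "y \<in> set_pmf (transition M x)" for y
    using that M Query.prems by (auto simp: po_markov_chain_def)
  then show ?case
    using Query by (auto simp: observed_Query relabel_simps bind_map_pmf intro!: bind_pmf_cong)
qed simp

text \<open>The law of the observations does not see the names of the states, and an
  \<open>enat\<close> is determined by its finite upper bounds.\<close>

lemma NAQC_relabel:
  assumes "a \<in> states M" "b \<in> states M"
  shows "NAQC (relabel h M) (h a) (h b) = NAQC M a b"
proof -
  have "NAQC (relabel h M) (h a) (h b) \<le> enat T \<longleftrightarrow> NAQC M a b \<le> enat T" for T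
    using assms
    by (subst (1 2) NAQC_le_iff_qtree)
      (simp_all add: M po_markov_chain_relabel relabel_simps observed_relabel)
  then show ?thesis by (metis antisym enat_ord_code(3) linorder_le_cases not_infinity_eq)
qed

end

lemma canonical_chain_relabel:
  assumes "canonical_chain M" "inj_on h (states M)"
  shows "canonical_chain (relabel h M)"
proof -
  have M: "po_markov_chain M" using assms by (simp add: canonical_chain_def)
  from assms(1) obtain s where s: "s \<in> states M" "transition M s = return_pmf s" "alphabet M = {0, 1}"
    "\<forall>x\<in>states M. observe M x = (if x = s then 1 else 0)"
    by (auto simp: canonical_chain_def)
  show ?thesis unfolding canonical_chain_def
  proof (intro conjI bexI[of _ "h s"] ballI)
    fix x assume "x \<in> states (relabel h M)"
    then show "observe (relabel h M) x = (if x = h s then 1 else 0)"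
      using s assms(2) by (auto simp: relabel_simps[OF M assms(2)] inj_on_eq_iff)
  qed (use s M assms(2) in \<open>auto simp: po_markov_chain_relabel relabel_simps\<close>)
qed

section \<open>Choice of the scale and the final bounds\<close>

lemma ex_scale_pmf:
  "\<exists>w :: nat pmf. finite (set_pmf w) \<and> (\<forall>j\<le>J. 1 / (real (Suc j) * real (Suc (Suc j))) \<le> pmf w j)"
proof -
  \<comment> \<open>The weights \<open>1 / ((j + 1) * (j + 2))\<close> telescope to
    \<open>1 - 1 / (J + 1)\<close> below \<open>J\<close>, and the rest is put on \<open>J\<close>.
    The support is finite, as the canonical chain has to be.\<close>
  define f where "f j = (if j < J then 1 / (real (Suc j) * real (Suc (Suc j)))
    else if j = J then 1 / real (Suc J) else 0)" for j
  have nonneg: "0 \<le> f j" for j by (simp add: f_def)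
  have "1 / (real (Suc j) * real (Suc (Suc j))) = 1 / real (Suc j) - 1 / real (Suc (Suc j))" for j
    by (simp add: field_simps)
  then have "(\<Sum>j<n. 1 / (real (Suc j) * real (Suc (Suc j)))) = 1 - 1 / real (Suc n)" for n
    by (simp only: sum_lessThan_telescope'[of "\<lambda>j. 1 / real (Suc j)"] of_nat_1 One_nat_def[symmetric] div_by_1)
  moreover have "(\<Sum>j\<le>J. f j) = (\<Sum>j<J. 1 / (real (Suc j) * real (Suc (Suc j)))) + 1 / real (Suc J)"
    by (simp add: lessThan_Suc_atMost[symmetric] f_def)
  ultimately have "(\<Sum>j\<le>J. f j) = 1" by simp
  then have prob: "(\<integral>\<^sup>+ j. ennreal (f j) \<partial>count_space UNIV) = 1"
    using nonneg by (subst nn_integral_count_space'[of "{..J}"]) (auto simp: f_def sum_ennreal)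
  have "1 / (real (Suc j) * real (Suc (Suc j))) \<le> f j" if "j \<le> J" for j
    using that by (auto simp: f_def intro!: divide_left_mono mult_pos_pos)
  moreover have "finite (set_pmf (embed_pmf f))"
    unfolding set_embed_pmf[OF nonneg prob] by (rule finite_subset[of _ "{..J}"]) (auto simp: f_def split: if_splits)
  ultimately show ?thesis
    by (intro exI[of _ "embed_pmf f"]) (simp add: pmf_embed_pmf[OF nonneg prob])
qed

text \<open>For this \<open>j\<close> the sinking probability lies between
  \<open>1 / (4 * n)\<close> and \<open>1 / (2 * n)\<close>.\<close>

lemma ex_power_two_between:
  assumes "1 \<le> n"
  shows "\<exists>j. 2 * n \<le> 2 ^ j \<and> 2 ^ j \<le> (4 * n :: nat)"
proof -
  define j where "j = (LEAST j. 2 * n \<le> 2 ^ j)"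
  have "2 * n \<le> 2 ^ (2 * n)" by (simp add: less_exp less_imp_le)
  then have j: "2 * n \<le> 2 ^ j" unfolding j_def by (rule LeastI)
  then obtain i where i: "j = Suc i" using assms by (cases j) auto
  then have "\<not> 2 * n \<le> 2 ^ i" using not_less_Least[of i "\<lambda>j. 2 * n \<le> 2 ^ j"] by (simp add: j_def)
  then show ?thesis using i j by (intro exI[of _ j]) auto
qed

text \<open>\<open>j + 2\<close> is at most \<open>4 + log 2 n\<close>, hence at most five times the
  logarithm on the right, which is at least 1; \<open>125 = 5 ^ 3\<close>.\<close>

lemma scale_le_log:
  assumes "1 \<le> n" "2 ^ j \<le> 4 * n" "1 \<le> (s :: nat)"
  shows "real (j + 2) ^ 3 \<le> 125 * log 2 (2 + real (s * n\<^sup>2)) ^ 3"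
proof -
  let ?L = "log 2 (2 + real (s * n\<^sup>2))"
  have "n \<le> s * n\<^sup>2" using assms by (simp add: power2_eq_square Suc_le_eq)
  then have "real n \<le> 2 + real (s * n\<^sup>2)" by linarith
  then have n: "log 2 (real n) \<le> ?L" using assms(1) by simp
  have "log 2 2 \<le> ?L" by (intro log_mono) auto
  then have L: "1 \<le> ?L" by simp
  have "real (2 ^ j) \<le> real (4 * n)" using assms(2) by (rule of_nat_mono)
  then have "log 2 (2 ^ j) \<le> log 2 (4 * real n)" by (intro log_mono) auto
  moreover have "log 2 (4 * real n) = 2 + log 2 (real n)"
    using assms(1) log_pow_cancel[of 2 2] by (simp add: log_mult)
  ultimately have "real j \<le> 2 + log 2 (real n)" by simp
  then have "real (j + 2) \<le> 5 * ?L" using n L by simp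
  then have "real (j + 2) ^ 3 \<le> (5 * ?L) ^ 3" by (intro power_mono) auto
  then show ?thesis by (simp add: power_mult_distrib)
qed

theorem theorem6p3:
  "\<exists>(c::real) (C::real) (k::nat). c > 0 \<and> C > 0 \<and>
     (\<forall>M :: ('s, 'o) pomc. po_markov_chain M \<longrightarrow>
       (\<exists>(N :: (nat, nat) pomc) (\<phi> :: 's \<Rightarrow> nat).
          canonical_chain N \<and> inj_on \<phi> (states M) \<and> \<phi> ` states M \<subseteq> states N \<and>
          (\<forall>a\<in>states M. \<forall>a'\<in>states M.
             ereal c * ereal_of_enat (enat (card (alphabet M)) * NAQC M a a')
               \<le> ereal_of_enat (NAQC N (\<phi> a) (\<phi> a')) \<and>
             ereal_of_enat (NAQC N (\<phi> a) (\<phi> a'))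
               \<le> soft_O_bound C k (enat (card (alphabet M)) * (max 1 (NAQC M a a'))\<^sup>2))))"
proof (rule exI[of _ 1], rule exI[of _ 160000], rule exI[of _ 3], intro conjI allI impI)
  fix M :: "('s, 'o) pomc" assume M: "po_markov_chain M"
  then obtain idx where "bij_betw idx (alphabet M) {0..<card (alphabet M)}"
    using ex_bij_betw_finite_nat by (metis po_markov_chain_def)
  then have idx: "bij_betw idx (alphabet M) {..<card (alphabet M)}" by (simp add: atLeast0LessThan)
  \<comment> \<open>A common bound for the finite complexities. An infinite one contributes an
    unspecified number, which can only enlarge \<open>B\<close>.\<close>
  define B where "B = Max (insert 1 ((\<lambda>(a, b). the_enat (NAQC M a b)) ` (states M \<times> states M)))"
  have fin: "finite (states M)" using M by (simp add: po_markov_chain_def)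
  have B: "1 \<le> B" unfolding B_def using fin by (intro Max_ge) auto
  have NAQC_le_B: "q \<le> B" if "a \<in> states M" "b \<in> states M" "NAQC M a b = enat q" for a b q
  proof -
    have "q \<in> (\<lambda>(a, b). the_enat (NAQC M a b)) ` (states M \<times> states M)"
      using that by (intro image_eqI[of _ _ "(a, b)"]) auto
    then show ?thesis unfolding B_def using fin by (intro Max_ge) auto
  qed
  \<comment> \<open>\<open>4 * B\<close> covers all scales that will be chosen, since
    \<open>j < 2 ^ j\<close> and \<open>2 ^ j\<close> is at most \<open>4 * n\<close>.\<close>
  obtain w where w: "finite (set_pmf w)"
    "\<And>j. j \<le> 4 * B \<Longrightarrow> 1 / (real (Suc j) * real (Suc (Suc j))) \<le> pmf w j"
    using ex_scale_pmf[of "4 * B"] by blast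
  interpret canonicalization M idx w
    using M idx w(1) by unfold_locales
  have canon: "po_markov_chain canon" using canonical_canon by (simp add: canonical_chain_def)
  then obtain h :: "'s cstate \<Rightarrow> nat" where h: "inj_on h (states canon)"
    using finite_imp_inj_to_nat_seg[of "states canon"] by (auto simp: po_markov_chain_def)
  define N where "N = relabel h canon"
  define \<phi> where "\<phi> a = h (Root a)" for a
  have Root: "Root a \<in> states canon" if "a \<in> states M" for a using that by (simp add: canon_def)
  have NAQC_N: "NAQC N (\<phi> a) (\<phi> b) = NAQC canon (Root a) (Root b)"
    if "a \<in> states M" "b \<in> states M" for a b
    unfolding N_def \<phi>_def using canon h Root that by (intro NAQC_relabel) auto
  show "\<exists>(N :: (nat, nat) pomc) (\<phi> :: 's \<Rightarrow> nat).
          canonical_chain N \<and> inj_on \<phi> (states M) \<and> \<phi> ` states M \<subseteq> states N \<and>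
          (\<forall>a\<in>states M. \<forall>a'\<in>states M.
             ereal 1 * ereal_of_enat (enat (card (alphabet M)) * NAQC M a a')
               \<le> ereal_of_enat (NAQC N (\<phi> a) (\<phi> a')) \<and>
             ereal_of_enat (NAQC N (\<phi> a) (\<phi> a'))
               \<le> soft_O_bound 160000 3 (enat (card (alphabet M)) * (max 1 (NAQC M a a'))\<^sup>2))"
  proof (intro exI[of _ N] exI[of _ \<phi>] conjI ballI)
    show "canonical_chain N" unfolding N_def by (rule canonical_chain_relabel[OF canonical_canon h])
    show "inj_on \<phi> (states M)" using h Root by (auto simp: \<phi>_def inj_on_def)
    show "\<phi> ` states M \<subseteq> states N" using Root by (auto simp: N_def \<phi>_def relabel_simps[OF canon h])
    fix a a' assume a: "a \<in> states M" "a' \<in> states M"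
    show "ereal 1 * ereal_of_enat (enat (card (alphabet M)) * NAQC M a a')
        \<le> ereal_of_enat (NAQC N (\<phi> a) (\<phi> a'))"
      using NAQC_lower[OF a] by (simp add: NAQC_N[OF a] one_ereal_def[symmetric] ereal_of_enat_le_iff)
    have s: "1 \<le> card (alphabet M)" using idx_less[OF a(1)] by simp
    show "ereal_of_enat (NAQC N (\<phi> a) (\<phi> a'))
        \<le> soft_O_bound 160000 3 (enat (card (alphabet M)) * (max 1 (NAQC M a a'))\<^sup>2)"
    proof (cases "NAQC M a a'")
      case (enat q)
      \<comment> \<open>If the observations of \<open>a\<close> and \<open>a'\<close> differ, then
        \<open>q = 0\<close>, while the \<open>Root\<close> states look alike and need queries;
        hence the maximum.\<close>
      define n where "n = max 1 q"
      have n: "1 \<le> n" "n \<le> B" "NAQC M a a' \<le> enat n" using B NAQC_le_B[OF a enat] enat by (auto simp: n_def)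
      obtain j where j: "2 * n \<le> 2 ^ j" "2 ^ j \<le> 4 * n" using ex_power_two_between[OF n(1)] by blast
      have "j < 2 ^ j" by (rule less_exp)
      then have "j \<le> 4 * B" using j n by linarith
      from NAQC_upper[OF a n(3,1) j w(2)[OF this]]
      have "ereal_of_enat (NAQC N (\<phi> a) (\<phi> a')) \<le> ereal_of_enat (enat (1280 * s * n\<^sup>2 * (j + 2) ^ 3))"
        by (simp only: NAQC_N[OF a] ereal_of_enat_le_iff)
      also have "\<dots> = ereal (1280 * real (s * n\<^sup>2) * real (j + 2) ^ 3)" by simp
      also have "\<dots> \<le> ereal (1280 * real (s * n\<^sup>2) * (125 * log 2 (2 + real (s * n\<^sup>2)) ^ 3))"
        unfolding ereal_less_eq using scale_le_log[OF n(1) j(2) s] by (intro mult_left_mono) auto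
      \<comment> \<open>\<open>160000 = 1280 * 125\<close>.\<close>
      also have "\<dots> = soft_O_bound 160000 3 (enat (s * n\<^sup>2))"
        by (simp add: soft_O_bound_def)
      also have "enat (s * n\<^sup>2) = enat s * (max 1 (NAQC M a a'))\<^sup>2"
        by (simp add: enat n_def power2_eq_square one_enat_def max_def)
      finally show ?thesis .
    next
      case infinity
      then show ?thesis using s by (simp add: soft_O_bound_def power2_eq_square imult_is_infinity zero_enat_def)
    qed
  qed
qed simp_all

end
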